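(* The Directed Steiner Tree problem can be solved in time $O^*(2^{O(dk)})$ on $d$-degenerated directed graphs, provided the subdigraph $D[T]$ induced by the terminals is acyclic.
   Context: Directed Steiner Tree (DST): the input is a directed graph $D=(V,A)$, a root $r\in V$, a set $T\subseteq V\setminus\{r\}$ of terminals and an integer $k$; the question is whether there is a set $S\subseteq V\setminus(T\cup\{r\})$ with $|S|\le k$ such that $D[S\cup T\cup\{r\}]$ contains a directed path from $r$ to every $t\in T$. $O^*(\cdot)$ suppresses factors polynomial in the input size. A digraph is $d$-degenerated if every subgraph of its underlying undirected graph has a vertex of degree at most $d$. *)

theory Defs
  imports "Graph_Theory.Graph_Theory"
begin

text \<open>
  Machine model: first-order recursive programs over binary trees (pure cons cells), in the style of
  Jones' languages WHILE and F. A variable access, a constant, a constructor, a selector, a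
  conditional and a function call each cost one time unit. Every step only touches a bounded number
  of cells (with sharing) and the only test is for the empty tree, so time in this model is
  polynomially related to time on Turing machines and on random access machines. The class of bounds
  of the form \<open>2^O(dk) * poly(n)\<close> is closed under polynomials and is hence the same for all
  of these models.
\<close>

datatype val = Nil_v | Pair_v val val

datatype expr =
    Var nat
  | NilE
  | PairE expr expr
  | FstE expr
  | SndE expr
  | IfE expr expr expr
  | CallE nat "expr list"

fun fst_v :: "val \<Rightarrow> val" where
  "fst_v Nil_v = Nil_v"
| "fst_v (Pair_v a b) = a"

fun snd_v :: "val \<Rightarrow> val" where
  "snd_v Nil_v = Nil_v"
| "snd_v (Pair_v a b) = b"

text \<open>
  A program is the list of the bodies of its functions, which may call each other by position.
  \<open>eval P env e v t\<close>: in the environment \<open>env\<close> (the argument values of the current call),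
  \<open>e\<close> evaluates to \<open>v\<close> in exactly \<open>t\<close> steps. A diverging computation has no derivation.
\<close>

type_synonym prog = "expr list"

inductive eval :: "prog \<Rightarrow> val list \<Rightarrow> expr \<Rightarrow> val \<Rightarrow> nat \<Rightarrow> bool"
  and evals :: "prog \<Rightarrow> val list \<Rightarrow> expr list \<Rightarrow> val list \<Rightarrow> nat \<Rightarrow> bool"
  for P :: prog
where
  eval_Var: "i < length env \<Longrightarrow> eval P env (Var i) (env ! i) 1"
| eval_Nil: "eval P env NilE Nil_v 1"
| eval_Pair: "eval P env e1 v1 t1 \<Longrightarrow> eval P env e2 v2 t2 \<Longrightarrow>
    eval P env (PairE e1 e2) (Pair_v v1 v2) (t1 + t2 + 1)"
| eval_Fst: "eval P env e v t \<Longrightarrow> eval P env (FstE e) (fst_v v) (t + 1)"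
| eval_Snd: "eval P env e v t \<Longrightarrow> eval P env (SndE e) (snd_v v) (t + 1)"
| eval_If_then: "eval P env e v t \<Longrightarrow> v \<noteq> Nil_v \<Longrightarrow> eval P env e1 v1 t1 \<Longrightarrow>
    eval P env (IfE e e1 e2) v1 (t + t1 + 1)"
| eval_If_else: "eval P env e Nil_v t \<Longrightarrow> eval P env e2 v2 t2 \<Longrightarrow>
    eval P env (IfE e e1 e2) v2 (t + t2 + 1)"
| eval_Call: "evals P env es vs t1 \<Longrightarrow> f < length P \<Longrightarrow> eval P vs (P ! f) v t2 \<Longrightarrow>
    eval P env (CallE f es) v (t1 + t2 + 1)"
| evals_Nil: "evals P env [] [] 0"
| evals_Cons: "eval P env e v t1 \<Longrightarrow> evals P env es vs t2 \<Longrightarrow>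
    evals P env (e # es) (v # vs) (t1 + t2)"

lemma eval_deterministic:
  "eval P env e v t \<Longrightarrow> eval P env e v' t' \<Longrightarrow> v' = v \<and> t' = t"
  "evals P env es vs s \<Longrightarrow> evals P env es vs' s' \<Longrightarrow> vs' = vs \<and> s' = s"
proof (induction arbitrary: v' t' and vs' s' rule: eval_evals.inducts)
  case (eval_Var i env)
  from eval_Var.prems show ?case by cases auto
next
  case (eval_Nil env)
  from eval_Nil.prems show ?case by cases auto
next
  case (eval_Pair env e1 v1 t1 e2 v2 t2)
  from eval_Pair.prems show ?case by cases (use eval_Pair.IH in auto)
next
  case (eval_Fst env e v t)
  from eval_Fst.prems show ?case by cases (use eval_Fst.IH in auto)
next
  case (eval_Snd env e v t)
  from eval_Snd.prems show ?case by cases (use eval_Snd.IH in auto)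
next
  case (eval_If_then env e v t e1 v1 t1 e2)
  from eval_If_then.prems show ?case by cases (use eval_If_then in blast)+
next
  case (eval_If_else env e t e2 v2 t2 e1)
  from eval_If_else.prems show ?case by cases (use eval_If_else in blast)+
next
  case (eval_Call env es vs t1 f v t2)
  from eval_Call.prems show ?case by cases (use eval_Call.IH in blast)
next
  case (evals_Nil env)
  from evals_Nil.prems show ?case by cases auto
next
  case (evals_Cons env e v t1 es vs t2)
  from evals_Cons.prems show ?case by cases (use evals_Cons.IH in blast)
qed

text \<open>The function at position 0 is the entry point.\<close>

definition runs_to :: "prog \<Rightarrow> val \<Rightarrow> val \<Rightarrow> nat \<Rightarrow> bool" where
  "runs_to P x v t \<longleftrightarrow> eval P [x] (CallE 0 [Var 0]) v t"

fun vsize :: "val \<Rightarrow> nat" where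
  "vsize Nil_v = 1"
| "vsize (Pair_v a b) = vsize a + vsize b + 1"

definition enc_bool :: "bool \<Rightarrow> val" where
  "enc_bool b = (if b then Pair_v Nil_v Nil_v else Nil_v)"

text \<open>Numbers are encoded in binary, least significant bit first.\<close>

fun enc_nat :: "nat \<Rightarrow> val" where
  "enc_nat n = (if n = 0 then Nil_v else Pair_v (enc_bool (odd n)) (enc_nat (n div 2)))"

declare enc_nat.simps [simp del]

fun enc_list :: "val list \<Rightarrow> val" where
  "enc_list [] = Nil_v"
| "enc_list (x # xs) = Pair_v x (enc_list xs)"

definition enc_arc :: "nat \<times> nat \<Rightarrow> val" where
  "enc_arc a = Pair_v (enc_nat (fst a)) (enc_nat (snd a))"

text \<open>
  \<open>dst_code D r T k x\<close>: the tree \<open>x\<close> is a description of the instance \<open>(D, r, T, k)\<close>, listing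
  vertices, arcs and terminals in some arbitrary order.
\<close>

definition dst_code :: "nat pair_pre_digraph \<Rightarrow> nat \<Rightarrow> nat set \<Rightarrow> nat \<Rightarrow> val \<Rightarrow> bool" where
  "dst_code D r T k x \<longleftrightarrow>
     (\<exists>vs es ts. distinct vs \<and> set vs = pverts D \<and>
                 distinct es \<and> set es = parcs D \<and>
                 distinct ts \<and> set ts = T \<and>
                 x = enc_list [enc_list (map enc_nat vs), enc_list (map enc_arc es),
                               enc_nat r, enc_list (map enc_nat ts), enc_nat k])"

definition dst_input :: "'a pair_pre_digraph \<Rightarrow> 'a \<Rightarrow> 'a set \<Rightarrow> bool" where
  "dst_input D r T \<longleftrightarrow> pair_fin_digraph D \<and> r \<in> pverts D \<and> T \<subseteq> pverts D - {r}"

definition dst_yes :: "'a pair_pre_digraph \<Rightarrow> 'a \<Rightarrow> 'a set \<Rightarrow> nat \<Rightarrow> bool" where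
  "dst_yes D r T k \<longleftrightarrow>
     (\<exists>S \<subseteq> pverts D - (T \<union> {r}). card S \<le> k \<and>
        (\<forall>t \<in> T. \<exists>p. pre_digraph.apath (with_proj D \<restriction> (S \<union> T \<union> {r})) r p t))"

definition acyclic_digraph :: "('a, 'b) pre_digraph \<Rightarrow> bool" where
  "acyclic_digraph G \<longleftrightarrow> (\<nexists>p. pre_digraph.cycle G p)"

text \<open>
  Undirected graphs are symmetric digraphs, so the degree of a vertex is the number of its
  neighbours. Loops of \<open>D\<close> are not part of the (simple) underlying graph and do not count.
\<close>

definition degenerated :: "nat \<Rightarrow> 'a pair_pre_digraph \<Rightarrow> bool" where
  "degenerated d D \<longleftrightarrow>
     (\<forall>H. subgraph H (with_proj (mk_symmetric (with_proj D))) \<and> symmetric H \<and> verts H \<noteq> {} \<longrightarrow>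
        (\<exists>v \<in> verts H. card {w. v \<rightarrow>\<^bsub>H\<^esub> w \<and> w \<noteq> v} \<le> d))"

end

theory Submission
  imports Defs
begin

text \<open>
  Since \<open>D[T]\<close> is acyclic, \<open>S\<close> is a solution as soon as it is reachable from \<open>r\<close> and dominates the
  source terminals, those without an in-neighbour in \<open>T \<union> {r}\<close>. Let \<open>A\<close> be the source terminals not
  yet dealt with, and call a nonterminal high if it has more than \<open>d\<close> out-neighbours in \<open>A\<close>. If \<open>D\<close> is
  \<open>d\<close>-degenerated, some \<open>w \<in> A\<close> has at most \<open>d\<close> high in-neighbours. Either one of them is in \<open>S\<close>: guess
  it, and remove its out-neighbours from \<open>A\<close>. Or \<open>w\<close> is dominated by a vertex of \<open>S\<close> that is not high:
  put \<open>w\<close> aside. A vertex of \<open>S\<close> is guessed at most once and is responsible for at most \<open>d\<close> terminals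
  put aside, so the guesses form a certificate of \<open>O(dk)\<close> bits. What remains is a Steiner tree problem
  with \<open>O(dk)\<close> targets, namely the guessed vertices and the terminals put aside, which dynamic
  programming over sets of targets solves in time polynomial in \<open>2^O(dk)\<close> and the size of \<open>D\<close>.

  The program lists all certificates of length \<open>O(dk)\<close>, which is the only step that takes more than
  polynomial time; the rest is polynomial in the size of this list, which also indexes the sets of
  targets. As \<open>d\<close> is not part of the input, \<open>d = 0, 1, ...\<close> are tried until no certificate leads to a
  state without a suitable \<open>w\<close>.
\<close>

section \<open>Realizable functions\<close>

text \<open>A suitable \<open>w\<close> exists since the bipartite graph between the high vertices
  and \<open>A\<close> has a vertex of degree at most \<open>d\<close>, and no high vertex
  qualifies. Trying an unverified \<open>d\<close> is safe for an asymmetric reason: acceptance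
  exhibits a solution whatever \<open>d\<close> is, and if no certificate gets stuck, every solution
  leads to acceptance. Degeneracy thus only ensures that the search over \<open>d\<close> stops. The
  constant 4 in the certificate length arises as follows. The symbol for the \<open>i\<close>-th
  candidate is written in unary, with length at most \<open>d + 1\<close>; a potential of at most
  \<open>2d\<close> per solution vertex pays for all symbols, so a run takes at most
  \<open>2dk\<close> units and yields at most \<open>2dk\<close> targets. A subset of the targets is
  a 0/1 word over the same alphabet, with at most 2 units per target. Two parameters are not bounded
  by the input size: \<open>k\<close>, given in binary, is cut off at the number of vertices before
  being written in unary, and the search over \<open>d\<close> must end by then too, because for
  \<open>k = 0\<close> the factor \<open>2^O(dk)\<close> absorbs nothing.\<close>

definition evalb :: "prog \<Rightarrow> val list \<Rightarrow> expr \<Rightarrow> val \<Rightarrow> nat \<Rightarrow> bool" where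
  "evalb P env e v t \<longleftrightarrow> (\<exists>t'\<le>t. eval P env e v t')"

lemma evalb_mono: "evalb P env e v t \<Longrightarrow> t \<le> u \<Longrightarrow> evalb P env e v u"
  unfolding evalb_def by (meson order_trans)

lemma evalb_Var0: "evalb P [v] (Var 0) v 1"
  unfolding evalb_def using eval_Var[of 0 "[v]" P] by auto

lemma evalb_Nil: "evalb P env NilE Nil_v 1"
  unfolding evalb_def using eval_Nil by auto

lemma evalb_Pair:
  "evalb P env e1 v1 t1 \<Longrightarrow> evalb P env e2 v2 t2 \<Longrightarrow>
    evalb P env (PairE e1 e2) (Pair_v v1 v2) (t1 + t2 + 1)"
  unfolding evalb_def by (meson eval_Pair add_mono le_refl)

lemma evalb_Fst: "evalb P env e v t \<Longrightarrow> evalb P env (FstE e) (fst_v v) (t + 1)"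
  unfolding evalb_def by (meson eval_Fst add_mono le_refl)

lemma evalb_Snd: "evalb P env e v t \<Longrightarrow> evalb P env (SndE e) (snd_v v) (t + 1)"
  unfolding evalb_def by (meson eval_Snd add_mono le_refl)

lemma evalb_If_then:
  "evalb P env e v t \<Longrightarrow> v \<noteq> Nil_v \<Longrightarrow> evalb P env e1 v1 t1 \<Longrightarrow>
    evalb P env (IfE e e1 e2) v1 (t + t1 + 1)"
  unfolding evalb_def by (meson eval_If_then add_mono le_refl)

lemma evalb_If_else:
  "evalb P env e Nil_v t \<Longrightarrow> evalb P env e2 v2 t2 \<Longrightarrow>
    evalb P env (IfE e e1 e2) v2 (t + t2 + 1)"
  unfolding evalb_def by (meson eval_If_else add_mono le_refl)

lemma evalb_Call:
  assumes "evalb P env e v t1" "f < length P" "evalb P [v] (P ! f) w t2"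
  shows "evalb P env (CallE f [e]) w (t1 + t2 + 1)"
proof -
  from assms(1) obtain s1 where s1: "s1 \<le> t1" "eval P env e v s1" by (auto simp: evalb_def)
  from assms(3) obtain s2 where s2: "s2 \<le> t2" "eval P [v] (P ! f) w s2" by (auto simp: evalb_def)
  have "evals P env [e] [v] (s1 + 0)" by (intro evals_Cons evals_Nil s1)
  from eval_Call[OF this assms(2) s2(2)] s1(1) s2(1) show ?thesis
    by (auto simp: evalb_def intro!: exI[of _ "s1 + s2 + 1"])
qed

lemma evalb_Call2:
  assumes "evalb P env e v t1" "evalb P env e' v' t1'" "f < length P" "evalb P [v, v'] (P ! f) w t2"
  shows "evalb P env (CallE f [e, e']) w (t1 + t1' + t2 + 1)"
proof -
  from assms(1) obtain s1 where s1: "s1 \<le> t1" "eval P env e v s1" by (auto simp: evalb_def)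
  from assms(2) obtain s1' where s1': "s1' \<le> t1'" "eval P env e' v' s1'" by (auto simp: evalb_def)
  from assms(4) obtain s2 where s2: "s2 \<le> t2" "eval P [v, v'] (P ! f) w s2" by (auto simp: evalb_def)
  have "evals P env [e, e'] [v, v'] (s1 + (s1' + 0))" by (intro evals_Cons evals_Nil s1 s1')
  from eval_Call[OF this assms(3) s2(2)] s1(1) s1'(1) s2(1) show ?thesis
    by (auto simp: evalb_def intro!: exI[of _ "s1 + s1' + s2 + 1"])
qed

text \<open>
  The code \<open>Q\<close> may be placed at any offset \<open>n\<close> and be followed by anything. So pieces of code are
  combined by appending them, and no call ever has to be relocated.
\<close>

definition code_for :: "nat \<Rightarrow> expr \<Rightarrow> prog \<Rightarrow> (val \<Rightarrow> val) \<Rightarrow> (val \<Rightarrow> nat) \<Rightarrow> bool" where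
  "code_for n e Q F T \<longleftrightarrow>
     (\<forall>P0 P1 v. length P0 = n \<longrightarrow> evalb (P0 @ Q @ P1) [v] e (F v) (T v))"

lemma code_forD: "code_for n e Q F T \<Longrightarrow> length P0 = n \<Longrightarrow> evalb (P0 @ Q @ P1) [v] e (F v) (T v)"
  by (simp add: code_for_def)

definition realizes :: "(val \<Rightarrow> val) \<Rightarrow> (val \<Rightarrow> nat) \<Rightarrow> bool" where
  "realizes F T \<longleftrightarrow> (\<forall>n. \<exists>e Q. code_for n e Q F T)"

lemma realizesI:
  assumes "\<And>n. \<exists>e Q. \<forall>P0 P1 v. length P0 = n \<longrightarrow> evalb (P0 @ Q @ P1) [v] e (F v) (T v)"
  shows "realizes F T"
  using assms unfolding realizes_def code_for_def by blast

lemma realizes_mono: "realizes F S \<Longrightarrow> (\<And>v. S v \<le> T v) \<Longrightarrow> realizes F T"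
  unfolding realizes_def code_for_def by (meson evalb_mono)

lemma realizes_id: "realizes (\<lambda>v. v) (\<lambda>_. 1)"
  by (intro realizesI exI[of _ "Var 0"]) (blast intro: evalb_Var0)

lemma realizes_Nil: "realizes (\<lambda>_. Nil_v) (\<lambda>_. 1)"
  by (intro realizesI exI[of _ "NilE"]) (blast intro: evalb_Nil)

lemma realizes_fst: "realizes F T \<Longrightarrow> realizes (\<lambda>v. fst_v (F v)) (\<lambda>v. T v + 1)"
  unfolding realizes_def code_for_def by (meson evalb_Fst)

lemma realizes_snd: "realizes F T \<Longrightarrow> realizes (\<lambda>v. snd_v (F v)) (\<lambda>v. T v + 1)"
  unfolding realizes_def code_for_def by (meson evalb_Snd)

lemma realizes_Pair:
  assumes "realizes F S" "realizes G T"
  shows "realizes (\<lambda>v. Pair_v (F v) (G v)) (\<lambda>v. S v + T v + 1)"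
proof (rule realizesI)
  fix n
  obtain e Q where "code_for n e Q F S"
    using assms(1) unfolding realizes_def by blast
  note 1 = code_forD[OF this]
  obtain e' Q' where "code_for (n + length Q) e' Q' G T"
    using assms(2) unfolding realizes_def by blast
  note 2 = code_forD[OF this]
  show "\<exists>e Q. \<forall>P0 P1 v. length P0 = n \<longrightarrow>
      evalb (P0 @ Q @ P1) [v] e (Pair_v (F v) (G v)) (S v + T v + 1)"
  proof (intro exI[of _ "PairE e e'"] exI[of _ "Q @ Q'"] allI impI)
    fix P0 P1 :: prog and v assume "length P0 = n"
    then show "evalb (P0 @ (Q @ Q') @ P1) [v] (PairE e e') (Pair_v (F v) (G v)) (S v + T v + 1)"
      using evalb_Pair[OF 1[of P0 "Q' @ P1" v], of e' "G v" "T v"] 2[of "P0 @ Q" P1 v] by simp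
  qed
qed

lemma realizes_if:
  assumes "realizes C R" "realizes F S" "realizes G T"
  shows "realizes (\<lambda>v. if C v \<noteq> Nil_v then F v else G v) (\<lambda>v. R v + S v + T v + 1)"
proof (rule realizesI)
  fix n
  obtain e Q where "code_for n e Q C R"
    using assms(1) unfolding realizes_def by blast
  note 1 = code_forD[OF this]
  obtain e' Q' where "code_for (n + length Q) e' Q' F S"
    using assms(2) unfolding realizes_def by blast
  note 2 = code_forD[OF this]
  obtain e'' Q'' where "code_for (n + length Q + length Q') e'' Q'' G T"
    using assms(3) unfolding realizes_def by blast
  note 3 = code_forD[OF this]
  show "\<exists>e Q. \<forall>P0 P1 v. length P0 = n \<longrightarrow>
      evalb (P0 @ Q @ P1) [v] e (if C v \<noteq> Nil_v then F v else G v) (R v + S v + T v + 1)"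
  proof (intro exI[of _ "IfE e e' e''"] exI[of _ "Q @ Q' @ Q''"] allI impI)
    fix P0 P1 :: prog and v assume l: "length P0 = n"
    let ?P = "P0 @ (Q @ Q' @ Q'') @ P1"
    have c: "evalb ?P [v] e (C v) (R v)" using 1[of P0 "Q' @ Q'' @ P1" v] l by simp
    have f: "evalb ?P [v] e' (F v) (S v)" using 2[of "P0 @ Q" "Q'' @ P1" v] l by simp
    have g: "evalb ?P [v] e'' (G v) (T v)" using 3[of "P0 @ Q @ Q'" P1 v] l by simp
    show "evalb ?P [v] (IfE e e' e'') (if C v \<noteq> Nil_v then F v else G v) (R v + S v + T v + 1)"
    proof (cases "C v = Nil_v")
      case True
      then show ?thesis using evalb_mono[OF evalb_If_else[OF c[unfolded True] g]] by simp
    next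
      case False
      then show ?thesis using evalb_mono[OF evalb_If_then[OF c False f]] by simp
    qed
  qed
qed

lemma realizes_comp:
  assumes "realizes F S" "realizes G T"
  shows "realizes (\<lambda>v. F (G v)) (\<lambda>v. T v + S (G v) + 1)"
proof (rule realizesI)
  fix n
  obtain e Q where "code_for n e Q F S"
    using assms(1) unfolding realizes_def by blast
  note 1 = code_forD[OF this]
  obtain e' Q' where "code_for (n + length Q) e' Q' G T"
    using assms(2) unfolding realizes_def by blast
  note 2 = code_forD[OF this]
  let ?f = "n + length Q + length Q'"
  show "\<exists>e Q. \<forall>P0 P1 v. length P0 = n \<longrightarrow>
      evalb (P0 @ Q @ P1) [v] e (F (G v)) (T v + S (G v) + 1)"
  \<comment> \<open>\<open>e\<close> expects its argument as the whole environment, so it becomes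
    the body of a new function placed after both pieces of code.\<close>
  proof (intro exI[of _ "CallE ?f [e']"] exI[of _ "Q @ Q' @ [e]"] allI impI)
    fix P0 P1 :: prog and v assume l: "length P0 = n"
    let ?P = "P0 @ (Q @ Q' @ [e]) @ P1"
    have g: "evalb ?P [v] e' (G v) (T v)" using 2[of "P0 @ Q" "[e] @ P1" v] l by simp
    have "?P = (P0 @ Q @ Q') @ e # P1" "?f = length (P0 @ Q @ Q')" using l by auto
    then have nth: "?P ! ?f = e" by (simp only: nth_append_length)
    have f: "evalb ?P [G v] (?P ! ?f) (F (G v)) (S (G v))"
      unfolding nth using 1[of P0 "Q' @ [e] @ P1" "G v"] l by simp
    show "evalb ?P [v] (CallE ?f [e']) (F (G v)) (T v + S (G v) + 1)"
      by (rule evalb_Call[OF g _ f]) (use l in simp)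
  qed
qed

section \<open>Iteration over lists\<close>

fun vlist :: "val \<Rightarrow> val list" where
  "vlist Nil_v = []"
| "vlist (Pair_v a b) = a # vlist b"

lemma vlist_enc_list [simp]: "vlist (enc_list xs) = xs"
  by (induction xs) auto

lemma enc_list_vlist [simp]: "enc_list (vlist v) = v"
  by (induction v rule: vlist.induct) auto

text \<open>Running time of the compiled loop: 6 units for the final test and exit, and 22 units as
  a generous allowance for the bookkeeping around each call of \<open>G\<close>.\<close>

fun fold_time :: "(val \<Rightarrow> val) \<Rightarrow> (val \<Rightarrow> nat) \<Rightarrow> val \<Rightarrow> val list \<Rightarrow> val \<Rightarrow> nat" where
  "fold_time G T p [] a = 6"
| "fold_time G T p (x # xs) a =
     T (Pair_v x (Pair_v a p)) + 22 + fold_time G T p xs (G (Pair_v x (Pair_v a p)))"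

lemma realizes_fold:
  assumes G: "realizes G T" and L: "realizes L TL" and I: "realizes I TI"
  shows "realizes (\<lambda>p. fold (\<lambda>x a. G (Pair_v x (Pair_v a p))) (vlist (L p)) (I p))
    (\<lambda>p. TL p + TI p + 4 + fold_time G T p (vlist (L p)) (I p))"
proof (rule realizesI)
  fix n
  obtain e Q where "code_for n e Q G T"
    using G unfolding realizes_def by blast
  note 1 = code_forD[OF this]
  obtain e' Q' where "code_for (n + length Q) e' Q' L TL"
    using L unfolding realizes_def by blast
  note 2 = code_forD[OF this]
  obtain e'' Q'' where "code_for (n + length Q + length Q') e'' Q'' I TI"
    using I unfolding realizes_def by blast
  note 3 = code_forD[OF this]
  let ?g = "n + length Q + length Q' + length Q''"
  \<comment> \<open>One tree holds the rest of the list, the accumulator and the fixed parameter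
    \<open>p\<close>; \<open>p\<close> has to travel along because a function sees only its own
    arguments.\<close>
  define b where "b = IfE (FstE (Var 0))
    (CallE (Suc ?g) [PairE (SndE (FstE (Var 0)))
      (PairE (CallE ?g [PairE (FstE (FstE (Var 0))) (SndE (Var 0))]) (SndE (SndE (Var 0))))])
    (FstE (SndE (Var 0)))"
  show "\<exists>e Q. \<forall>P0 P1 v. length P0 = n \<longrightarrow>
      evalb (P0 @ Q @ P1) [v] e (fold (\<lambda>x a. G (Pair_v x (Pair_v a v))) (vlist (L v)) (I v))
        (TL v + TI v + 4 + fold_time G T v (vlist (L v)) (I v))"
  proof (intro exI[of _ "CallE (Suc ?g) [PairE e' (PairE e'' (Var 0))]"]
      exI[of _ "Q @ Q' @ Q'' @ [e, b]"] allI impI)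
    fix P0 P1 :: prog and v assume l: "length P0 = n"
    define P where "P = P0 @ (Q @ Q' @ Q'' @ [e, b]) @ P1"
    have "P = (P0 @ Q @ Q' @ Q'') @ e # b # P1" "?g = length (P0 @ Q @ Q' @ Q'')" using l by (auto simp: P_def)
    then have nth1: "P ! ?g = e" by (simp only: nth_append_length)
    have "P = (P0 @ Q @ Q' @ Q'' @ [e]) @ b # P1" "Suc ?g = length (P0 @ Q @ Q' @ Q'' @ [e])"
      using l by (auto simp: P_def)
    then have nth2: "P ! Suc ?g = b" by (simp only: nth_append_length)
    have gl: "?g < length P" "Suc ?g < length P" using l by (auto simp: P_def)
    have g: "evalb P [u] (P ! ?g) (G u) (T u)" for u
      unfolding nth1 using 1[of P0 "Q' @ Q'' @ [e, b] @ P1" u] l by (simp add: P_def)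
    have loop: "evalb P [Pair_v w (Pair_v a v)] b
        (fold (\<lambda>x a. G (Pair_v x (Pair_v a v))) (vlist w) a) (fold_time G T v (vlist w) a)" for w a
    proof (induction w arbitrary: a rule: vlist.induct)
      case 1
      let ?u = "Pair_v Nil_v (Pair_v a v)"
      have "evalb P [?u] (FstE (Var 0)) Nil_v 2"
        using evalb_Fst[OF evalb_Var0[of P ?u]] by (simp add: numeral_2_eq_2)
      moreover have "evalb P [?u] (FstE (SndE (Var 0))) a 3"
        using evalb_Fst[OF evalb_Snd[OF evalb_Var0[of P ?u]]] by (simp add: numeral_eq_Suc)
      ultimately show ?case unfolding b_def using evalb_If_else[of P "[?u]" "FstE (Var 0)" 2] by fastforce
    next
      case (2 x w)
      let ?u = "Pair_v (Pair_v x w) (Pair_v a v)"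
      let ?q = "Pair_v x (Pair_v a v)"
      have 0: "evalb P [?u] (FstE (Var 0)) (Pair_v x w) 2"
        using evalb_Fst[OF evalb_Var0[of P ?u]] by (simp add: numeral_2_eq_2)
      have s: "evalb P [?u] (SndE (Var 0)) (Pair_v a v) 2"
        using evalb_Snd[OF evalb_Var0[of P ?u]] by (simp add: numeral_2_eq_2)
      have ss: "evalb P [?u] (SndE (SndE (Var 0))) v 3"
        using evalb_Snd[OF s] by (simp add: numeral_eq_Suc)
      have sf: "evalb P [?u] (SndE (FstE (Var 0))) w 3"
        using evalb_Snd[OF 0] by (simp add: numeral_eq_Suc)
      have ff: "evalb P [?u] (FstE (FstE (Var 0))) x 3"
        using evalb_Fst[OF 0] by (simp add: numeral_eq_Suc)
      note G = evalb_Call[OF evalb_Pair[OF ff s] gl(1) g]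
      note arg = evalb_Pair[OF sf evalb_Pair[OF G ss]]
      note step = evalb_Call[OF arg gl(2), unfolded nth2, OF "2.IH"]
      have "evalb P [?u] b (fold (\<lambda>x a. G (Pair_v x (Pair_v a v))) (vlist w) (G ?q))
         (2 + (3 + (3 + 2 + 1 + T ?q + 1 + 3 + 1) + 1 + fold_time G T v (vlist w) (G ?q) + 1) + 1)"
        using evalb_If_then[OF 0 _ step] unfolding b_def by simp
      then show ?case by (auto elim!: evalb_mono)
    qed
    have L': "evalb P [v] e' (L v) (TL v)" using 2[of "P0 @ Q" "Q'' @ [e, b] @ P1" v] l by (simp add: P_def)
    have I': "evalb P [v] e'' (I v) (TI v)" using 3[of "P0 @ Q @ Q'" "[e, b] @ P1" v] l by (simp add: P_def)
    have "evalb P [v] (CallE (Suc ?g) [PairE e' (PairE e'' (Var 0))])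
      (fold (\<lambda>x a. G (Pair_v x (Pair_v a v))) (vlist (L v)) (I v))
      (TL v + (TI v + 1 + 1) + 1 + fold_time G T v (vlist (L v)) (I v) + 1)"
      using evalb_Call[OF evalb_Pair[OF L' evalb_Pair[OF I' evalb_Var0]] gl(2), unfolded nth2, OF loop] .
    then show "evalb (P0 @ (Q @ Q' @ Q'' @ [e, b]) @ P1) [v] (CallE (Suc ?g) [PairE e' (PairE e'' (Var 0))])
      (fold (\<lambda>x a. G (Pair_v x (Pair_v a v))) (vlist (L v)) (I v))
      (TL v + TI v + 4 + fold_time G T v (vlist (L v)) (I v))"
      unfolding P_def[symmetric] by (rule evalb_mono) simp
  qed
qed

lemma enc_bool_neq_Nil [simp]: "enc_bool b \<noteq> Nil_v \<longleftrightarrow> b" "enc_bool b = Nil_v \<longleftrightarrow> \<not> b"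
  by (auto simp: enc_bool_def)

text \<open>The two trees are traversed in parallel, and every recursive call consumes a node of the
  first one, so its size alone bounds the time.\<close>

lemma realizes_eq:
  "realizes (\<lambda>v. enc_bool (fst_v v = snd_v v)) (\<lambda>v. 30 * vsize (fst_v v) + 10)"
proof (rule realizesI)
  fix n
  define b where "b =
    IfE (Var 0)
      (IfE (Var 1)
         (IfE (CallE n [FstE (Var 0), FstE (Var 1)]) (CallE n [SndE (Var 0), SndE (Var 1)]) NilE)
         NilE)
      (IfE (Var 1) NilE (PairE NilE NilE))"
  show "\<exists>e Q. \<forall>P0 P1 v. length P0 = n \<longrightarrow>
      evalb (P0 @ Q @ P1) [v] e (enc_bool (fst_v v = snd_v v)) (30 * vsize (fst_v v) + 10)"
  proof (intro exI[of _ "CallE n [FstE (Var 0), SndE (Var 0)]"] exI[of _ "[b]"] allI impI)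
    fix P0 P1 :: prog and v assume l: "length P0 = n"
    define P where "P = P0 @ [b] @ P1"
    have nth: "P ! n = b" "n < length P" using l nth_append_length[of P0 b P1] by (auto simp: P_def)
    have v0: "evalb P [x, y] (Var 0) x 1" and v1: "evalb P [x, y] (Var 1) y 1" for x y
      unfolding evalb_def using eval_Var[of 0 "[x, y]" P] eval_Var[of 1 "[x, y]" P] by auto
    have loop: "evalb P [x, y] b (enc_bool (x = y)) (30 * vsize x)" for x y
    proof (induction x arbitrary: y)
      case Nil_v
      show ?case
      proof (cases y)
        case Nil_v
        have "evalb P [Nil_v, Nil_v] b (Pair_v Nil_v Nil_v) (1 + (1 + (1 + 1 + 1) + 1) + 1)"
          unfolding b_def by (intro evalb_If_else v0 v1 evalb_Pair evalb_Nil)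
        then show ?thesis using Nil_v by (auto simp: enc_bool_def elim: evalb_mono)
      next
        case (Pair_v a b')
        have "evalb P [Nil_v, y] b Nil_v (1 + (1 + 1 + 1) + 1)"
          unfolding b_def by (intro evalb_If_else[OF v0] evalb_If_then[OF v1] evalb_Nil) (simp add: Pair_v)
        then show ?thesis using Pair_v by (auto simp: enc_bool_def elim: evalb_mono)
      qed
    next
      case (Pair_v a c)
      show ?case
      proof (cases y)
        case Nil_v
        have "evalb P [Pair_v a c, y] b Nil_v (1 + (1 + 1 + 1) + 1)"
          unfolding b_def Nil_v by (intro evalb_If_then[OF v0] evalb_If_else[OF v1] evalb_Nil) simp
        then show ?thesis using Nil_v by (auto simp: enc_bool_def elim: evalb_mono)
      next
        case y: (Pair_v a' c')
        note V0 = v0[of "Pair_v a c" y] and V1 = v1[of "Pair_v a c" y]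
        have eq1: "evalb P [Pair_v a c, y] (CallE n [FstE (Var 0), FstE (Var 1)])
            (enc_bool (a = a')) (1 + 1 + (1 + 1) + 30 * vsize a + 1)"
          using evalb_Call2[OF evalb_Fst[OF V0] evalb_Fst[OF V1] nth(2)] Pair_v(1)[of a']
          by (simp add: nth y)
        have eq2: "evalb P [Pair_v a c, y] (CallE n [SndE (Var 0), SndE (Var 1)])
            (enc_bool (c = c')) (1 + 1 + (1 + 1) + 30 * vsize c + 1)"
          using evalb_Call2[OF evalb_Snd[OF V0] evalb_Snd[OF V1] nth(2)] Pair_v(2)[of c']
          by (simp add: nth y)
        show ?thesis
        proof (cases "a = a'")
          case True
          have "evalb P [Pair_v a c, y] b (enc_bool (c = c'))
            (1 + (1 + ((1 + 1 + (1 + 1) + 30 * vsize a + 1) + (1 + 1 + (1 + 1) + 30 * vsize c + 1) + 1) + 1) + 1)"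
            unfolding b_def
            by (intro evalb_If_then[OF V0] evalb_If_then[OF V1] evalb_If_then[OF eq1] eq2)
              (auto simp: True y)
          then show ?thesis using True y by (auto elim!: evalb_mono)
        next
          case False
          have "evalb P [Pair_v a c, y] b Nil_v
            (1 + (1 + ((1 + 1 + (1 + 1) + 30 * vsize a + 1) + 1 + 1) + 1) + 1)"
            unfolding b_def using eq1 False
            by (intro evalb_If_then[OF V0] evalb_If_then[OF V1] evalb_If_else evalb_Nil)
              (auto simp: y enc_bool_def)
          then show ?thesis using False y by (auto simp: enc_bool_def elim!: evalb_mono)
        qed
      qed
    qed
    have "evalb P [v] (CallE n [FstE (Var 0), SndE (Var 0)]) (enc_bool (fst_v v = snd_v v))
        (1 + 1 + (1 + 1) + 30 * vsize (fst_v v) + 1)"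
      using evalb_Call2[OF evalb_Fst[OF evalb_Var0] evalb_Snd[OF evalb_Var0] nth(2)] loop
      by (simp add: nth)
    then show "evalb (P0 @ [b] @ P1) [v] (CallE n [FstE (Var 0), SndE (Var 0)]) (enc_bool (fst_v v = snd_v v))
        (30 * vsize (fst_v v) + 10)"
      unfolding P_def[symmetric] by (rule evalb_mono) simp
  qed
qed

text \<open>The search may diverge, so it is no instance of \<open>realizes\<close>, which describes
  total functions. \<open>Nil_v\<close> stands for "no answer yet". \<open>H\<close> is evaluated
  once for the test and once more for the answer, whence the factor 2.\<close>

lemma realizes_search:
  assumes H: "realizes H T" and N: "realizes N S"
  shows "\<exists>e Q. \<forall>P0 P1 v j. length P0 = n \<longrightarrow> (\<forall>i<j. H ((N ^^ i) v) = Nil_v) \<longrightarrow>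
    H ((N ^^ j) v) \<noteq> Nil_v \<longrightarrow>
    evalb (P0 @ Q @ P1) [v] e (fst_v (H ((N ^^ j) v)))
      (\<Sum>i\<le>j. 2 * T ((N ^^ i) v) + S ((N ^^ i) v) + 10)"
proof -
  obtain e Q where "code_for n e Q H T"
    using H unfolding realizes_def by blast
  note 1 = code_forD[OF this]
  obtain e' Q' where "code_for (n + length Q) e' Q' N S"
    using N unfolding realizes_def by blast
  note 2 = code_forD[OF this]
  let ?f = "n + length Q + length Q'"
  define b where "b = IfE e (FstE e) (CallE ?f [e'])"
  show ?thesis
  proof (intro exI[of _ "CallE ?f [Var 0]"] exI[of _ "Q @ Q' @ [b]"] allI impI)
    fix P0 P1 :: prog and v j
    assume l: "length P0 = n"
      and nil: "\<forall>i<j. H ((N ^^ i) v) = Nil_v" and stop: "H ((N ^^ j) v) \<noteq> Nil_v"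
    define P where "P = P0 @ (Q @ Q' @ [b]) @ P1"
    have "P = (P0 @ Q @ Q') @ b # P1" "?f = length (P0 @ Q @ Q')" using l by (auto simp: P_def)
    then have nth: "P ! ?f = b" by (simp only: nth_append_length)
    have fl: "?f < length P" using l by (simp add: P_def)
    have h: "evalb P [u] e (H u) (T u)" for u using 1[of P0 "Q' @ [b] @ P1" u] l by (simp add: P_def)
    have s: "evalb P [u] e' (N u) (S u)" for u using 2[of "P0 @ Q" "[b] @ P1" u] l by (simp add: P_def)
    have loop: "evalb P [v] b (fst_v (H ((N ^^ j) v)))
        ((\<Sum>i\<le>j. 2 * T ((N ^^ i) v) + S ((N ^^ i) v) + 5))"
      using nil stop
    proof (induction j arbitrary: v)
      case 0
      have "evalb P [v] b (fst_v (H v)) (T v + (T v + 1) + 1)"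
        unfolding b_def using 0 by (intro evalb_If_then[OF h] evalb_Fst h) simp
      then show ?case by (auto elim: evalb_mono)
    next
      case (Suc j)
      have nv: "H v = Nil_v" using Suc.prems(1) by (metis funpow_0 zero_less_Suc)
      have nil': "\<forall>i<j. H ((N ^^ Suc i) v) = Nil_v" using Suc.prems(1) by (meson Suc_mono)
      have sh: "(N ^^ i) (N v) = (N ^^ Suc i) v" for i by (simp add: funpow_swap1)
      have ih: "evalb P [N v] b (fst_v (H ((N ^^ Suc j) v)))
          (\<Sum>i\<le>j. 2 * T ((N ^^ Suc i) v) + S ((N ^^ Suc i) v) + 5)"
        using Suc.IH[of "N v", unfolded sh] nil' Suc.prems(2) by blast
      have "evalb P [v] b (fst_v (H ((N ^^ Suc j) v)))
        (T v + (S v + (\<Sum>i\<le>j. 2 * T ((N ^^ Suc i) v) + S ((N ^^ Suc i) v) + 5) + 1) + 1)"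
        unfolding b_def using h[of v] nv ih
        by (intro evalb_If_else evalb_Call[OF s fl]) (auto simp: nth b_def)
      then show ?case by (rule evalb_mono) (simp add: sum.atMost_Suc_shift del: funpow.simps sum.atMost_Suc)
    qed
    have "evalb P [v] (CallE ?f [Var 0]) (fst_v (H ((N ^^ j) v)))
        (1 + (\<Sum>i\<le>j. 2 * T ((N ^^ i) v) + S ((N ^^ i) v) + 5) + 1)"
      using evalb_Call[OF evalb_Var0 fl] loop by (simp add: nth)
    moreover have "1 + (\<Sum>i\<le>j. 2 * T ((N ^^ i) v) + S ((N ^^ i) v) + 5) + 1
        \<le> (\<Sum>i\<le>j. 2 * T ((N ^^ i) v) + S ((N ^^ i) v) + 10)"
      by (simp add: sum.distrib)
    ultimately show "evalb (P0 @ (Q @ Q' @ [b]) @ P1) [v] (CallE ?f [Var 0]) (fst_v (H ((N ^^ j) v)))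
        (\<Sum>i\<le>j. 2 * T ((N ^^ i) v) + S ((N ^^ i) v) + 10)"
      unfolding P_def[symmetric] by (rule evalb_mono)
  qed
qed

section \<open>Polynomial time\<close>

text \<open>Polynomials with natural coefficients; they are monotone, so bounds on sizes may be
  substituted into them.\<close>

inductive pb :: "(nat \<Rightarrow> nat) \<Rightarrow> bool" where
  pb_const: "pb (\<lambda>_. c)"
| pb_id: "pb (\<lambda>s. s)"
| pb_add: "pb p \<Longrightarrow> pb q \<Longrightarrow> pb (\<lambda>s. p s + q s)"
| pb_mult: "pb p \<Longrightarrow> pb q \<Longrightarrow> pb (\<lambda>s. p s * q s)"

lemma pb_mono: "pb p \<Longrightarrow> s \<le> t \<Longrightarrow> p s \<le> p t"
  by (induction rule: pb.induct) (auto intro: add_mono mult_mono)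

lemma pb_comp: "pb p \<Longrightarrow> pb q \<Longrightarrow> pb (\<lambda>s. p (q s))"
  by (induction rule: pb.induct) (auto intro: pb.intros)

text \<open>One constant serves as coefficient and exponent, as in the final bound. The case
  \<open>s = 0\<close> is excluded since \<open>0 ^ c\<close> vanishes for positive
  \<open>c\<close>.\<close>

lemma pb_bound: "pb p \<Longrightarrow> \<exists>c. \<forall>s\<ge>1. p s \<le> c * s ^ c"
proof (induction rule: pb.induct)
  case (pb_const c)
  show ?case by (intro exI[of _ c]) simp
next
  case pb_id
  show ?case by (intro exI[of _ 1]) simp
next
  case (pb_add p q)
  then obtain a b where ab: "\<forall>s\<ge>1. p s \<le> a * s ^ a" "\<forall>s\<ge>1. q s \<le> b * s ^ b" by blast
  show ?case
  proof (intro exI[of _ "a + b"] allI impI)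
    fix s :: nat assume s: "s \<ge> 1"
    have "a * s ^ a \<le> a * s ^ (a + b)" "b * s ^ b \<le> b * s ^ (a + b)"
      using s by (auto intro!: mult_le_mono power_increasing)
    with ab s show "p s + q s \<le> (a + b) * s ^ (a + b)"
      by (metis add_mono add_mult_distrib order_trans)
  qed
next
  case (pb_mult p q)
  then obtain a b where ab: "\<forall>s\<ge>1. p s \<le> a * s ^ a" "\<forall>s\<ge>1. q s \<le> b * s ^ b" by blast
  show ?case
  proof (intro exI[of _ "a * b + a + b"] allI impI)
    fix s :: nat assume s: "s \<ge> 1"
    have "p s * q s \<le> (a * s ^ a) * (b * s ^ b)" using ab s by (intro mult_le_mono) auto
    also have "\<dots> = (a * b) * s ^ (a + b)" by (simp add: power_add)
    also have "\<dots> \<le> (a * b + a + b) * s ^ (a * b + a + b)"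
      using s by (intro mult_le_mono power_increasing) auto
    finally show "p s * q s \<le> (a * b + a + b) * s ^ (a * b + a + b)" .
  qed
qed

text \<open>With sharing, a tree can be exponentially larger than the time used to build it, so the size of
  the result has to be bounded separately.\<close>

definition ptime :: "(val \<Rightarrow> val) \<Rightarrow> bool" where
  "ptime F \<longleftrightarrow> (\<exists>p. pb p \<and> (\<forall>v. vsize (F v) \<le> p (vsize v)) \<and> realizes F (\<lambda>v. p (vsize v)))"

lemma ptimeI:
  assumes "pb p" "\<And>v. vsize (F v) \<le> p (vsize v)" "realizes F T" "pb q" "\<And>v. T v \<le> q (vsize v)"
  shows "ptime F"
  unfolding ptime_def
proof (intro exI[of _ "\<lambda>s. p s + q s"] conjI allI)
  show "pb (\<lambda>s. p s + q s)" using assms by (intro pb.intros)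
  show "vsize (F v) \<le> p (vsize v) + q (vsize v)" for v using assms(2)[of v] by simp
  show "realizes F (\<lambda>v. p (vsize v) + q (vsize v))"
    by (rule realizes_mono[OF assms(3)]) (use assms(5) trans_le_add2 in blast)
qed

lemma vsize_pos: "0 < vsize v"
  by (cases v) auto

lemma vsize_fst: "vsize (fst_v v) \<le> vsize v" and vsize_snd: "vsize (snd_v v) \<le> vsize v"
  by (cases v; simp)+

lemma ptime_id: "ptime (\<lambda>v. v)"
  by (rule ptimeI[OF pb_id _ realizes_id pb_const]) auto

lemma ptime_Nil: "ptime (\<lambda>v. Nil_v)"
  by (rule ptimeI[OF pb_const _ realizes_Nil pb_const]) auto

lemma ptime_fst:
  assumes "ptime F" shows "ptime (\<lambda>v. fst_v (F v))"
proof -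
  from assms obtain p where p: "pb p" "\<And>v. vsize (F v) \<le> p (vsize v)" "realizes F (\<lambda>v. p (vsize v))"
    by (auto simp: ptime_def)
  show ?thesis
    by (rule ptimeI[OF p(1) _ realizes_fst[OF p(3)] pb_add[OF p(1) pb_const]])
      (auto intro: order_trans[OF vsize_fst p(2)])
qed

lemma ptime_snd:
  assumes "ptime F" shows "ptime (\<lambda>v. snd_v (F v))"
proof -
  from assms obtain p where p: "pb p" "\<And>v. vsize (F v) \<le> p (vsize v)" "realizes F (\<lambda>v. p (vsize v))"
    by (auto simp: ptime_def)
  show ?thesis
    by (rule ptimeI[OF p(1) _ realizes_snd[OF p(3)] pb_add[OF p(1) pb_const]])
      (auto intro: order_trans[OF vsize_snd p(2)])
qed

lemma ptime_Pair:
  assumes "ptime F" "ptime G" shows "ptime (\<lambda>v. Pair_v (F v) (G v))"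
proof -
  from assms obtain p where p: "pb p" "\<And>v. vsize (F v) \<le> p (vsize v)" "realizes F (\<lambda>v. p (vsize v))"
    by (auto simp: ptime_def)
  from assms obtain q where q: "pb q" "\<And>v. vsize (G v) \<le> q (vsize v)" "realizes G (\<lambda>v. q (vsize v))"
    by (auto simp: ptime_def)
  have pq: "pb (\<lambda>s. p s + q s + 1)" using p q by (intro pb.intros)
  show ?thesis
    by (rule ptimeI[OF pq _ realizes_Pair[OF p(3) q(3)] pq]) (auto intro: add_mono p(2) q(2))
qed

lemma ptime_If:
  assumes "ptime C" "ptime F" "ptime G" shows "ptime (\<lambda>v. if C v \<noteq> Nil_v then F v else G v)"
proof -
  from assms obtain r where r: "pb r" "\<And>v. vsize (C v) \<le> r (vsize v)" "realizes C (\<lambda>v. r (vsize v))"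
    by (auto simp: ptime_def)
  from assms obtain p where p: "pb p" "\<And>v. vsize (F v) \<le> p (vsize v)" "realizes F (\<lambda>v. p (vsize v))"
    by (auto simp: ptime_def)
  from assms obtain q where q: "pb q" "\<And>v. vsize (G v) \<le> q (vsize v)" "realizes G (\<lambda>v. q (vsize v))"
    by (auto simp: ptime_def)
  have b: "pb (\<lambda>s. r s + p s + q s + 1)" using p q r by (intro pb.intros)
  show ?thesis
    by (rule ptimeI[OF b _ realizes_if[OF r(3) p(3) q(3)] b]) (use p(2) q(2) in \<open>auto intro: trans_le_add1 trans_le_add2 le_SucI\<close>)
qed

lemma ptime_comp:
  assumes "ptime F" "ptime G" shows "ptime (\<lambda>v. F (G v))"
proof -
  from assms obtain p where p: "pb p" "\<And>v. vsize (F v) \<le> p (vsize v)" "realizes F (\<lambda>v. p (vsize v))"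
    by (auto simp: ptime_def)
  from assms obtain q where q: "pb q" "\<And>v. vsize (G v) \<le> q (vsize v)" "realizes G (\<lambda>v. q (vsize v))"
    by (auto simp: ptime_def)
  have b: "pb (\<lambda>s. q s + p (q s) + 1)" by (intro pb_add pb_const q pb_comp[OF p(1) q(1)])
  have pq: "p (vsize (G v)) \<le> p (q (vsize v))" for v by (rule pb_mono[OF p(1) q(2)])
  show ?thesis
  proof (rule ptimeI[OF pb_comp[OF p(1) q(1)] _ realizes_comp[OF p(3) q(3)] b])
    show "vsize (F (G v)) \<le> p (q (vsize v))" for v by (rule order_trans[OF p(2) pq])
    show "q (vsize v) + p (vsize (G v)) + 1 \<le> q (vsize v) + p (q (vsize v)) + 1" for v
      using pq by simp
  qed
qed

lemma vsize_vlist: "x \<in> set (vlist v) \<Longrightarrow> vsize x \<le> vsize v"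
  by (induction v rule: vlist.induct) auto

lemma length_vlist: "length (vlist v) < vsize v"
  by (induction v rule: vlist.induct) auto

lemma vsize_enc_list: "vsize (enc_list xs) = 1 + (\<Sum>x\<leftarrow>xs. vsize x + 1)"
  by (induction xs) auto

lemma fold_time_bound:
  assumes "\<And>i. i < length xs \<Longrightarrow>
      T (Pair_v (xs ! i) (Pair_v (fold (\<lambda>x a. G (Pair_v x (Pair_v a p))) (take i xs) a) p)) \<le> b"
  shows "fold_time G T p xs a \<le> length xs * (b + 22) + 6"
  using assms
proof (induction xs arbitrary: a)
  case Nil
  then show ?case by simp
next
  case (Cons x xs)
  have "T (Pair_v x (Pair_v a p)) \<le> b" using Cons.prems[of 0] by simp
  moreover have "fold_time G T p xs (G (Pair_v x (Pair_v a p))) \<le> length xs * (b + 22) + 6"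
    by (rule Cons.IH) (use Cons.prems[of "Suc _"] in simp)
  ultimately show ?case by simp
qed

text \<open>A size bound on the final value would not suffice: the time of each call depends on the
  accumulator of that round, which iterated doubling could make exponential. Hence
  \<open>bound\<close> covers every prefix of the list.\<close>

lemma ptime_fold:
  assumes G: "ptime (\<lambda>q. G (fst_v q) (fst_v (snd_v q)) (snd_v (snd_v q)))"
    and L: "ptime L" and I: "ptime I"
    and b: "pb b"
    and bound: "\<And>p i. vsize (fold (\<lambda>x a. G x a p) (take i (vlist (L p))) (I p)) \<le> b (vsize p)"
  shows "ptime (\<lambda>p. fold (\<lambda>x a. G x a p) (vlist (L p)) (I p))"
proof -
  let ?G = "\<lambda>q. G (fst_v q) (fst_v (snd_v q)) (snd_v (snd_v q))"
  from G obtain g where g: "pb g" "realizes ?G (\<lambda>v. g (vsize v))"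
    by (auto simp: ptime_def)
  from L obtain l where l: "pb l" "\<And>v. vsize (L v) \<le> l (vsize v)" "realizes L (\<lambda>v. l (vsize v))"
    by (auto simp: ptime_def)
  from I obtain c where c: "pb c" "realizes I (\<lambda>v. c (vsize v))"
    by (auto simp: ptime_def)
  let ?h = "\<lambda>s. g (l s + (b s + s + 1) + 1)"
  let ?q = "\<lambda>s. l s + c s + 4 + (l s * (?h s + 22) + 6)"
  have "pb (\<lambda>s. l s + (b s + s + 1) + 1)" by (intro pb_add pb_const pb_id l b)
  then have q: "pb ?q" by (intro pb_add pb_mult pb_const pb_id l b c pb_comp[OF g(1)])
  let ?T = "\<lambda>p. fold_time ?G (\<lambda>v. g (vsize v)) p (vlist (L p)) (I p)"
  have R: "realizes (\<lambda>p. fold (\<lambda>x a. G x a p) (vlist (L p)) (I p))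
      (\<lambda>p. l (vsize p) + c (vsize p) + 4 + ?T p)"
    using realizes_fold[OF g(2) l(3) c(2)] by simp
  show ?thesis
  proof (rule ptimeI[OF b _ R q])
    fix p
    show "vsize (fold (\<lambda>x a. G x a p) (vlist (L p)) (I p)) \<le> b (vsize p)"
      using bound[where p = p and i = "length (vlist (L p))"] by simp
    have "fold_time ?G (\<lambda>v. g (vsize v)) p (vlist (L p)) (I p) \<le>
        length (vlist (L p)) * (?h (vsize p) + 22) + 6"
    proof (rule fold_time_bound, rule pb_mono[OF g(1)])
      fix i assume "i < length (vlist (L p))"
      then have "vsize (vlist (L p) ! i) \<le> l (vsize p)"
        by (rule order_trans[OF vsize_vlist[OF nth_mem] l(2)])
      then show "vsize (Pair_v (vlist (L p) ! i) (Pair_v (fold (\<lambda>x a. ?G (Pair_v x (Pair_v a p)))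
            (take i (vlist (L p))) (I p)) p)) \<le> l (vsize p) + (b (vsize p) + vsize p + 1) + 1"
        using bound[of p i] by simp
    qed
    also have "\<dots> \<le> l (vsize p) * (?h (vsize p) + 22) + 6"
      using length_vlist[of "L p"] l(2)[of p] by (intro add_mono mult_le_mono) auto
    finally show "l (vsize p) + c (vsize p) + 4 + ?T p \<le> ?q (vsize p)" by simp
  qed
qed

text \<open>Additive polynomial growth per round is harmless, as there are only polynomially many
  rounds; the invariant lets the increment be bounded independently of the accumulator.\<close>

lemma ptime_fold_inv:
  assumes G: "ptime (\<lambda>q. G (fst_v q) (fst_v (snd_v q)) (snd_v (snd_v q)))"
    and L: "ptime L" and I: "ptime I" and c: "pb c"
    and init: "\<And>p. Inv p (I p)"
    and step: "\<And>p x a. Inv p a \<Longrightarrow> x \<in> set (vlist (L p)) \<Longrightarrow> Inv p (G x a p)"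
    and size: "\<And>p x a. Inv p a \<Longrightarrow> x \<in> set (vlist (L p)) \<Longrightarrow> vsize (G x a p) \<le> vsize a + c (vsize p)"
  shows "ptime (\<lambda>p. fold (\<lambda>x a. G x a p) (vlist (L p)) (I p))"
proof -
  from L obtain l where l: "pb l" "\<And>v. vsize (L v) \<le> l (vsize v)"
    by (auto simp: ptime_def)
  from I obtain b where b: "pb b" "\<And>v. vsize (I v) \<le> b (vsize v)"
    by (auto simp: ptime_def)
  have inv: "Inv p (fold (\<lambda>x a. G x a p) xs a) \<and>
      vsize (fold (\<lambda>x a. G x a p) xs a) \<le> vsize a + length xs * c (vsize p)"
    if "set xs \<subseteq> set (vlist (L p))" "Inv p a" for p xs a
    using that
  proof (induction xs arbitrary: a)
    case (Cons x xs)
    have x: "x \<in> set (vlist (L p))" and xs: "set xs \<subseteq> set (vlist (L p))" using Cons.prems by auto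
    from Cons.IH[OF xs step[OF Cons.prems(2) x]] size[OF Cons.prems(2) x] show ?case by simp
  qed simp
  show ?thesis
  proof (rule ptime_fold[OF G L I])
    show "pb (\<lambda>s. b s + l s * c s)" by (intro pb_add pb_mult b l c)
    fix p i
    have "vsize (fold (\<lambda>x a. G x a p) (take i (vlist (L p))) (I p))
        \<le> vsize (I p) + length (take i (vlist (L p))) * c (vsize p)"
      using inv[where xs = "take i (vlist (L p))", OF set_take_subset init] by blast
    also have "\<dots> \<le> b (vsize p) + l (vsize p) * c (vsize p)"
      using length_vlist[of "L p"] l(2)[of p] b(2)[of p] by (intro add_mono mult_le_mono) auto
    finally show "vsize (fold (\<lambda>x a. G x a p) (take i (vlist (L p))) (I p))
        \<le> b (vsize p) + l (vsize p) * c (vsize p)" .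
  qed
qed

section \<open>List programs\<close>

definition ptest :: "(val \<Rightarrow> bool) \<Rightarrow> bool" where
  "ptest Q \<longleftrightarrow> ptime (\<lambda>v. enc_bool (Q v))"

lemma ptime_if:
  assumes "ptest Q" "ptime F" "ptime G" shows "ptime (\<lambda>v. if Q v then F v else G v)"
  using ptime_If[OF assms[unfolded ptest_def]] by simp

lemma ptime_unit: "ptime (\<lambda>v. Pair_v Nil_v Nil_v)"
  by (intro ptime_Pair ptime_Nil)

lemma ptest_neq_Nil:
  assumes "ptime F" shows "ptest (\<lambda>v. F v \<noteq> Nil_v)"
  unfolding ptest_def enc_bool_def by (rule ptime_If[OF assms ptime_unit ptime_Nil])

lemma ptest_not: assumes "ptest Q" shows "ptest (\<lambda>v. \<not> Q v)"
  using ptime_if[OF assms ptime_Nil ptime_unit] unfolding ptest_def enc_bool_def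
  by (rule back_subst[of ptime]) auto

lemma ptest_conj: assumes "ptest Q" "ptest R" shows "ptest (\<lambda>v. Q v \<and> R v)"
  using ptime_if[OF assms(1) ptime_if[OF assms(2) ptime_unit ptime_Nil] ptime_Nil]
  unfolding ptest_def enc_bool_def by (rule back_subst[of ptime]) auto

lemma ptest_disj: assumes "ptest Q" "ptest R" shows "ptest (\<lambda>v. Q v \<or> R v)"
  using ptime_if[OF assms(1) ptime_unit ptime_if[OF assms(2) ptime_unit ptime_Nil]]
  unfolding ptest_def enc_bool_def by (rule back_subst[of ptime]) auto

lemma ptest_eq: assumes "ptime F" "ptime G" shows "ptest (\<lambda>v. F v = G v)"
proof -
  have "ptime (\<lambda>v. enc_bool (fst_v v = snd_v v))"
  proof (rule ptimeI[OF pb_const[of 3] _ realizes_eq])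
    show "pb (\<lambda>s. 30 * s + 10)" by (intro pb.intros)
    show "30 * vsize (fst_v v) + 10 \<le> 30 * vsize v + 10" for v using vsize_fst[of v] by simp
  qed (simp add: enc_bool_def)
  from ptime_comp[OF this ptime_Pair[OF assms]] show ?thesis by (simp add: ptest_def)
qed

definition app_v :: "val \<Rightarrow> val \<Rightarrow> val" where
  "app_v a b = enc_list (vlist a @ vlist b)"

lemma vlist_app_v [simp]: "vlist (app_v a b) = vlist a @ vlist b"
  by (simp add: app_v_def)

lemma fold_Pair_v: "fold Pair_v xs a = enc_list (rev xs @ vlist a)"
  by (induction xs arbitrary: a) auto

lemma vsize_fold_Pair_v: "vsize (fold Pair_v (take i (vlist a)) b) \<le> vsize a + vsize b"
proof (induction a arbitrary: b i rule: vlist.induct)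
  case 1
  then show ?case by simp
next
  case (2 x a)
  show ?case
  proof (cases i)
    case (Suc j)
    then show ?thesis using "2.IH"[where b = "Pair_v x b" and i = j] by simp
  qed simp
qed

lemma ptime_fold_Pair:
  assumes "ptime F" "ptime G" shows "ptime (\<lambda>v. fold Pair_v (vlist (F v)) (G v))"
proof -
  have "ptime (\<lambda>v. fold (\<lambda>x a. Pair_v x a) (vlist (fst_v v)) (snd_v v))"
    by (rule ptime_fold[where b = "\<lambda>s. s + s"])
      (auto intro!: ptime_Pair ptime_fst ptime_snd ptime_id pb.intros
        intro: order_trans[OF vsize_fold_Pair_v] add_mono vsize_fst vsize_snd)
  from ptime_comp[OF this ptime_Pair[OF assms]] show ?thesis by simp
qed

lemma ptime_app:
  assumes "ptime F" "ptime G" shows "ptime (\<lambda>v. app_v (F v) (G v))"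
  \<comment> \<open>The inner fold reverses the first list, the outer one reverses it again in front
    of the second.\<close>
  using ptime_fold_Pair[OF ptime_fold_Pair[OF assms(1) ptime_Nil] assms(2)]
  by (simp add: fold_Pair_v app_v_def)

lemma sum_list_vlist: "(\<Sum>x\<leftarrow>vlist v. vsize x + 1) + 1 = vsize v"
  using vsize_enc_list[of "vlist v"] by simp

text \<open>Each element is paired with the parameter \<open>p\<close>, so the body may refer to
  both. Maps, filters and bounded quantifiers are all reduced to this one loop.\<close>

lemma ptime_concat:
  assumes L: "ptime L" and B: "ptime (\<lambda>q. B (fst_v q) (snd_v q))"
  shows "ptime (\<lambda>p. enc_list (concat (map (\<lambda>x. vlist (B x p)) (vlist (L p)))))"
proof -
  from L obtain l where l: "pb l" "\<And>v. vsize (L v) \<le> l (vsize v)"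
    by (auto simp: ptime_def)
  from B obtain b where b: "pb b" "\<And>q. vsize (B (fst_v q) (snd_v q)) \<le> b (vsize q)"
    by (auto simp: ptime_def)
  have fold: "fold (\<lambda>x a. app_v a (B x p)) xs a =
      enc_list (vlist a @ concat (map (\<lambda>x. vlist (B x p)) xs))" for xs a p
    by (induction xs arbitrary: a) (auto simp: app_v_def)
  have "ptime (\<lambda>p. fold (\<lambda>x a. app_v a (B x p)) (vlist (L p)) Nil_v)"
  proof (rule ptime_fold[where b = "\<lambda>s. 1 + l s * b (l s + s + 1)"])
    have "ptime (\<lambda>q. B (fst_v q) (snd_v (snd_v q)))"
      using ptime_comp[OF B ptime_Pair[OF ptime_fst[OF ptime_id] ptime_snd[OF ptime_snd[OF ptime_id]]]]
      by simp
    then show "ptime (\<lambda>q. app_v (fst_v (snd_v q)) (B (fst_v q) (snd_v (snd_v q))))"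
      by (intro ptime_app ptime_fst ptime_snd ptime_id)
    show "pb (\<lambda>s. 1 + l s * b (l s + s + 1))"
      by (intro pb_add pb_mult pb_const l pb_comp[OF b(1)] pb_id)
  next
    fix p i
    let ?xs = "take i (vlist (L p))" and ?c = "b (l (vsize p) + vsize p + 1)"
    have el: "vsize (B x p) \<le> ?c" if "x \<in> set ?xs" for x
    proof -
      have "vsize x \<le> l (vsize p)" by (rule order_trans[OF vsize_vlist[OF in_set_takeD[OF that]] l(2)])
      then have "b (vsize (Pair_v x p)) \<le> ?c" by (intro pb_mono[OF b(1)]) simp
      then show ?thesis using b(2)[of "Pair_v x p"] by simp
    qed
    have sum: "vsize (enc_list (concat (map (\<lambda>x. vlist (B x p)) xs))) \<le> 1 + length xs * ?c"
      if "\<And>x. x \<in> set xs \<Longrightarrow> vsize (B x p) \<le> ?c" for xs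
      using that
    proof (induction xs)
      case (Cons x xs)
      have "vsize (enc_list (concat (map (\<lambda>x. vlist (B x p)) xs))) \<le> 1 + length xs * ?c"
        using Cons by simp
      moreover have "(\<Sum>z\<leftarrow>vlist (B x p). vsize z + 1) \<le> ?c"
        using Cons.prems[of x] sum_list_vlist[of "B x p"] by simp
      ultimately show ?case by (simp add: vsize_enc_list)
    qed simp
    have "vsize (enc_list (concat (map (\<lambda>x. vlist (B x p)) ?xs))) \<le> 1 + length ?xs * ?c"
      by (rule sum) (rule el)
    also have "\<dots> \<le> 1 + l (vsize p) * ?c"
      using length_vlist[of "L p"] l(2)[of p] by (intro add_mono mult_le_mono) auto
    finally show "vsize (fold (\<lambda>x a. app_v a (B x p)) ?xs Nil_v) \<le> 1 + l (vsize p) * ?c"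
      by (simp add: fold)
  qed (intro L ptime_Nil)+
  then show ?thesis by (simp add: fold)
qed

lemma ptime_map:
  assumes "ptime L" "ptime (\<lambda>q. B (fst_v q) (snd_v q))"
  shows "ptime (\<lambda>p. enc_list (map (\<lambda>x. B x p) (vlist (L p))))"
  using ptime_concat[OF assms(1), of "\<lambda>x p. Pair_v (B x p) Nil_v"] assms(2)
  by (simp add: ptime_Pair ptime_Nil)

lemma ptime_filter:
  assumes "ptime L" "ptest (\<lambda>q. Q (fst_v q) (snd_v q))"
  shows "ptime (\<lambda>p. enc_list (filter (\<lambda>x. Q x p) (vlist (L p))))"
proof -
  have "concat (map (\<lambda>x. vlist (if Q x p then Pair_v x Nil_v else Nil_v)) xs) =
      filter (\<lambda>x. Q x p) xs" for p xs
    by (induction xs) auto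
  then show ?thesis
    using ptime_concat[OF assms(1), of "\<lambda>x p. if Q x p then Pair_v x Nil_v else Nil_v"] assms(2)
    by (simp add: ptime_if ptime_Pair ptime_fst ptime_Nil ptime_id)
qed

lemma enc_list_eq_Nil [simp]: "enc_list xs = Nil_v \<longleftrightarrow> xs = []"
  by (cases xs) auto

lemma ptest_Bex:
  assumes "ptime L" "ptest (\<lambda>q. Q (fst_v q) (snd_v q))"
  shows "ptest (\<lambda>p. \<exists>x\<in>set (vlist (L p)). Q x p)"
  using ptest_neq_Nil[OF ptime_filter[OF assms]] by (simp add: filter_empty_conv)

lemma ptest_Ball:
  assumes "ptime L" "ptest (\<lambda>q. Q (fst_v q) (snd_v q))"
  shows "ptest (\<lambda>p. \<forall>x\<in>set (vlist (L p)). Q x p)"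
  using ptest_not[OF ptest_Bex[OF assms(1), of "\<lambda>x p. \<not> Q x p"]] assms(2)
  by (simp add: ptest_not)

lemma ptest_mem:
  assumes "ptime F" "ptime L"
  shows "ptest (\<lambda>p. F p \<in> set (vlist (L p)))"
proof -
  have "ptest (\<lambda>q. fst_v q = F (snd_v q))"
    by (intro ptest_eq ptime_fst ptime_id ptime_comp[OF assms(1)] ptime_snd)
  from ptest_Bex[OF assms(2), of "\<lambda>x p. x = F p", OF this] show ?thesis by simp
qed

lemma fold_snd_v: "fold (\<lambda>x. snd_v) xs a = enc_list (drop (length xs) (vlist a))"
proof (induction xs arbitrary: a)
  case (Cons x xs)
  then show ?case by (cases a) auto
qed simp

text \<open>Arithmetic on unary numbers: dropping is truncated subtraction, which also provides
  comparison and indexing.\<close>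

lemma ptime_drop:
  assumes "ptime F" "ptime G"
  shows "ptime (\<lambda>p. enc_list (drop (length (vlist (F p))) (vlist (G p))))"
proof -
  have le: "vsize (fold (\<lambda>x. snd_v) xs a) \<le> vsize a" for xs :: "val list" and a
  proof (induction xs arbitrary: a)
    case (Cons x xs)
    then show ?case using vsize_snd[of a] order_trans by fastforce
  qed simp
  have "ptime (\<lambda>p. fold (\<lambda>x. snd_v) (vlist (fst_v p)) (snd_v p))"
    by (rule ptime_fold[where b = "\<lambda>s. s" and G = "\<lambda>x a p. snd_v a"])
      (auto intro!: ptime_fst ptime_snd ptime_id pb.intros order_trans[OF le] vsize_snd)
  from ptime_comp[OF this ptime_Pair[OF assms]] show ?thesis by (simp add: fold_snd_v)
qed

lemma ptest_length_le:
  assumes "ptime F" "ptime G"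
  shows "ptest (\<lambda>p. length (vlist (F p)) \<le> length (vlist (G p)))"
  using ptest_not[OF ptest_neq_Nil[OF ptime_drop[OF assms(2,1)]]] by simp

text \<open>Inside a filter or a quantifier a parameter \<open>I p\<close> turns into
  \<open>I (snd_v q)\<close>. Such goals are met by adding \<open>assms[THEN ptime_comp]\<close> to
  these rules; \<open>ptime_comp\<close> in its general form would unify with every goal.\<close>

lemmas ptime_intros = ptime_id ptime_Nil ptime_fst ptime_snd ptime_Pair ptime_app ptime_map
  ptime_filter ptime_drop ptest_length_le ptest_mem ptest_Bex ptest_Ball ptest_eq ptest_conj
  ptest_disj ptest_not ptest_neq_Nil ptime_if

section \<open>The algorithm\<close>

text \<open>
  An instance is the tree \<open>(V, (E, (r, (T, K))))\<close>, where the budget is the length of \<open>K\<close>. All numbers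
  computed by the program are unary, that is, they are lengths of lists.
\<close>

definition V_of :: "val \<Rightarrow> val" where "V_of I = fst_v I"
definition E_of :: "val \<Rightarrow> val" where "E_of I = fst_v (snd_v I)"
definition r_of :: "val \<Rightarrow> val" where "r_of I = fst_v (snd_v (snd_v I))"
definition T_of :: "val \<Rightarrow> val" where "T_of I = fst_v (snd_v (snd_v (snd_v I)))"
definition K_of :: "val \<Rightarrow> val" where "K_of I = snd_v (snd_v (snd_v (snd_v I)))"

definition arc :: "val \<Rightarrow> val \<Rightarrow> val \<Rightarrow> bool" where
  "arc I u v \<longleftrightarrow> Pair_v u v \<in> set (vlist (E_of I))"

text \<open>Vertices that may be used without spending budget.\<close>

definition free :: "val \<Rightarrow> val \<Rightarrow> bool" where
  "free I v \<longleftrightarrow> v = r_of I \<or> v \<in> set (vlist (T_of I))"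

definition start :: "val \<Rightarrow> val" where
  "start I = enc_list (filter (\<lambda>t. \<not> (\<exists>u\<in>set (vlist (V_of I)). free I u \<and> arc I u t)) (vlist (T_of I)))"

definition nbrs :: "val \<Rightarrow> val \<Rightarrow> val \<Rightarrow> val" where
  "nbrs I A y = enc_list (filter (\<lambda>t. arc I y t) (vlist A))"

definition highs :: "val \<Rightarrow> val \<Rightarrow> val \<Rightarrow> val" where
  "highs I d A = enc_list (filter (\<lambda>y. \<not> free I y \<and>
     \<not> length (vlist (nbrs I A y)) \<le> length (vlist d)) (vlist (V_of I)))"

definition cands :: "val \<Rightarrow> val \<Rightarrow> val \<Rightarrow> val \<Rightarrow> val" where
  "cands I d A w = enc_list (filter (\<lambda>y. arc I y w) (vlist (highs I d A)))"

definition goods :: "val \<Rightarrow> val \<Rightarrow> val \<Rightarrow> val" where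
  "goods I d A = enc_list (filter (\<lambda>w. length (vlist (cands I d A w)) \<le> length (vlist d)) (vlist A))"

definition remove :: "val \<Rightarrow> val \<Rightarrow> val" where
  "remove w A = enc_list (filter (\<lambda>t. t \<noteq> w) (vlist A))"

definition undominated :: "val \<Rightarrow> val \<Rightarrow> val \<Rightarrow> val" where
  "undominated I A y = enc_list (filter (\<lambda>t. \<not> arc I y t) (vlist A))"

text \<open>An index beyond the list yields \<open>Nil_v\<close>, which may even code the vertex 0.
  This is harmless, since soundness does not depend on which vertex a certificate names.\<close>

definition nth_cand :: "val \<Rightarrow> val \<Rightarrow> val \<Rightarrow> val \<Rightarrow> val" where
  "nth_cand I d A s =
     fst_v (enc_list (drop (length (vlist (snd_v s))) (vlist (cands I d A (fst_v (goods I d A))))))"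

text \<open>
  A state \<open>(Q, A)\<close> consists of the targets \<open>Q\<close> chosen so far and the source terminals \<open>A\<close> not yet dealt
  with. The symbol 0 makes the first good terminal a target, the symbol \<open>i + 1\<close> makes its \<open>i\<close>-th
  candidate a target.
\<close>

definition step :: "val \<Rightarrow> val \<Rightarrow> val \<Rightarrow> val \<Rightarrow> val" where
  "step I d s st =
    (if goods I d (snd_v st) = Nil_v then st
     else if s = Nil_v then
       Pair_v (Pair_v (fst_v (goods I d (snd_v st))) (fst_v st))
         (remove (fst_v (goods I d (snd_v st))) (snd_v st))
     else
       Pair_v (Pair_v (nth_cand I d (snd_v st) s) (fst_v st))
         (undominated I (snd_v st) (nth_cand I d (snd_v st) s)))"

definition run :: "val \<Rightarrow> val \<Rightarrow> val \<Rightarrow> val" where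
  "run I d c = fold (step I d) (vlist c) (Pair_v Nil_v (start I))"

section \<open>Dynamic programming over sets of targets\<close>

definition mask_step :: "val \<Rightarrow> val \<Rightarrow> val" where
  "mask_step s a =
    Pair_v (if s = Nil_v then fst_v a else Pair_v (fst_v (snd_v a)) (fst_v a)) (snd_v (snd_v a))"

text \<open>A certificate read as a 0/1 word that selects entries of \<open>Q\<close>.\<close>

definition mask :: "val \<Rightarrow> val \<Rightarrow> val" where
  "mask Q c = fst_v (fold mask_step (vlist c) (Pair_v Nil_v Q))"

text \<open>The suffixes of \<open>K\<close> are the unary budgets from 0 up to its length.\<close>

definition tails :: "val \<Rightarrow> val" where
  "tails K = fold (\<lambda>_ a. Pair_v (snd_v (fst_v a)) a) (vlist K) (Pair_v K Nil_v)"

text \<open>The universe of the iteration: it bounds the size of every later table in advance,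
  polynomially in the certificate list.\<close>

definition facts :: "val \<Rightarrow> val \<Rightarrow> val \<Rightarrow> val" where
  "facts I Q B = enc_list (concat (map (\<lambda>v. vlist (enc_list (concat (map (\<lambda>c.
      vlist (enc_list (map (\<lambda>j. Pair_v v (Pair_v (mask Q c) j)) (vlist (tails (K_of I))))))
      (vlist B))))) (vlist (V_of I))))"

definition weight :: "val \<Rightarrow> val \<Rightarrow> val" where
  "weight I u = (if free I u then Nil_v else Pair_v Nil_v Nil_v)"

text \<open>
  The fact \<open>(v, (X, j))\<close> says that all of \<open>X\<close> can be reached from \<open>v\<close> by means of at most \<open>j\<close>
  nonterminals, not counting \<open>v\<close>.
\<close>

definition derivable :: "val \<Rightarrow> val \<Rightarrow> val \<Rightarrow> bool" where
  "derivable I M f \<longleftrightarrow>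
    (\<forall>x\<in>set (vlist (fst_v (snd_v f))). x = fst_v f) \<or>
    (\<exists>g\<in>set (vlist M). \<exists>h\<in>set (vlist M). fst_v g = fst_v f \<and> arc I (fst_v f) (fst_v h) \<and>
       snd_v (snd_v f) = app_v (snd_v (snd_v g)) (app_v (snd_v (snd_v h)) (weight I (fst_v h))) \<and>
       (\<forall>x\<in>set (vlist (fst_v (snd_v f))).
          x \<in> set (vlist (fst_v (snd_v g))) \<or> x \<in> set (vlist (fst_v (snd_v h)))))"

definition derive_facts :: "val \<Rightarrow> val \<Rightarrow> val \<Rightarrow> val" where
  "derive_facts I U M = enc_list (filter (\<lambda>f. derivable I M f) (vlist U))"

text \<open>As many rounds as vertices suffice: merging a leaf of an out-tree into its parent takes
  one round.\<close>

definition table :: "val \<Rightarrow> val \<Rightarrow> val" where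
  "table I U = fold (\<lambda>_ M. derive_facts I U M) (vlist (V_of I)) Nil_v"

definition reaches :: "val \<Rightarrow> val \<Rightarrow> val \<Rightarrow> bool" where
  "reaches I Q B \<longleftrightarrow> (\<exists>f\<in>set (vlist (table I (facts I Q B))). fst_v f = r_of I \<and>
     (\<forall>x\<in>set (vlist Q). x \<in> set (vlist (fst_v (snd_v f)))))"

definition accepts :: "val \<Rightarrow> val \<Rightarrow> val \<Rightarrow> val \<Rightarrow> bool" where
  "accepts I d B c \<longleftrightarrow> snd_v (run I d c) = Nil_v \<and> reaches I (fst_v (run I d c)) B"

definition stuck :: "val \<Rightarrow> val \<Rightarrow> val \<Rightarrow> bool" where
  "stuck I d c \<longleftrightarrow> snd_v (run I d c) \<noteq> Nil_v \<and> goods I d (snd_v (run I d c)) = Nil_v"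

text \<open>The empty tree means that \<open>d\<close> is too small; otherwise the answer is the first component.\<close>

definition decide :: "val \<Rightarrow> val \<Rightarrow> val \<Rightarrow> val" where
  "decide I d B =
    (if \<exists>c\<in>set (vlist B). accepts I d B c then Pair_v (Pair_v Nil_v Nil_v) Nil_v
     else if \<exists>c\<in>set (vlist B). stuck I d c then Nil_v
     else Pair_v Nil_v Nil_v)"

text \<open>A word is kept, prefixed by the symbol 0, or has its first symbol raised by one. So a
  word appears after at most as many rounds as its symbols cost, the symbol \<open>n\<close> costing
  \<open>n + 1\<close>.\<close>

definition grow :: "val \<Rightarrow> val" where
  "grow B = enc_list (concat (map (\<lambda>c. vlist
     (Pair_v c (Pair_v (Pair_v Nil_v c) (Pair_v (Pair_v (Pair_v Nil_v (fst_v c)) (snd_v c)) Nil_v))))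
     (vlist B)))"

definition certs :: "val \<Rightarrow> val" where
  "certs m = fold (\<lambda>_ B. grow B) (vlist m) (Pair_v Nil_v Nil_v)"

definition four_dk :: "val \<Rightarrow> val \<Rightarrow> val" where
  "four_dk I d = enc_list (concat (map (\<lambda>_. vlist
     (app_v (app_v (K_of I) (K_of I)) (app_v (K_of I) (K_of I)))) (vlist d)))"

definition solve :: "val \<Rightarrow> val" where
  "solve p = decide (fst_v p) (snd_v p) (certs (four_dk (fst_v p) (snd_v p)))"

definition double :: "val \<Rightarrow> val \<Rightarrow> val" where
  "double a b = app_v (app_v a a) (if b = Nil_v then Nil_v else Pair_v Nil_v Nil_v)"

definition trunc :: "val \<Rightarrow> val \<Rightarrow> val" where
  "trunc n a = enc_list (drop (length (vlist (enc_list (drop (length (vlist n)) (vlist a))))) (vlist a))"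

text \<open>Horner's rule on the binary digits, most significant first, hence the reversal.
  Truncating after every doubling keeps the accumulator small, as the number itself may be
  exponential in the length of its code.\<close>

definition unary :: "val \<Rightarrow> val \<Rightarrow> val" where
  "unary n k = fold (\<lambda>b a. trunc n (double a b)) (vlist (fold Pair_v (vlist k) Nil_v)) Nil_v"

definition prep :: "val \<Rightarrow> val" where
  "prep x = Pair_v (V_of x) (Pair_v (E_of x) (Pair_v (r_of x) (Pair_v (T_of x)
     (unary (V_of x) (fst_v (K_of x))))))"

section \<open>Time analysis\<close>

lemma ptime_V_of: "ptime F \<Longrightarrow> ptime (\<lambda>p. V_of (F p))"
  and ptime_E_of: "ptime F \<Longrightarrow> ptime (\<lambda>p. E_of (F p))"
  and ptime_r_of: "ptime F \<Longrightarrow> ptime (\<lambda>p. r_of (F p))"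
  and ptime_T_of: "ptime F \<Longrightarrow> ptime (\<lambda>p. T_of (F p))"
  and ptime_K_of: "ptime F \<Longrightarrow> ptime (\<lambda>p. K_of (F p))"
  unfolding V_of_def E_of_def r_of_def T_of_def K_of_def by (intro ptime_fst ptime_snd; assumption)+

lemmas ptime_of = ptime_V_of ptime_E_of ptime_r_of ptime_T_of ptime_K_of

lemma ptest_arc:
  assumes "ptime I" "ptime F" "ptime G" shows "ptest (\<lambda>p. arc (I p) (F p) (G p))"
  unfolding arc_def by (intro ptime_intros ptime_of assms)

lemma ptest_free:
  assumes "ptime I" "ptime F" shows "ptest (\<lambda>p. free (I p) (F p))"
  unfolding free_def by (intro ptime_intros ptime_of assms)

lemma ptime_start:
  assumes "ptime I" shows "ptime (\<lambda>p. start (I p))"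
  unfolding start_def by (intro ptime_intros ptime_of ptest_arc ptest_free assms[THEN ptime_comp])

lemma ptime_nbrs:
  assumes "ptime I" "ptime A" "ptime Y" shows "ptime (\<lambda>p. nbrs (I p) (A p) (Y p))"
  unfolding nbrs_def by (intro ptime_intros ptest_arc assms[THEN ptime_comp])

lemma ptime_highs:
  assumes "ptime I" "ptime D" "ptime A" shows "ptime (\<lambda>p. highs (I p) (D p) (A p))"
  unfolding highs_def
  by (intro ptime_intros ptime_of ptest_free ptime_nbrs assms[THEN ptime_comp])

lemma ptime_cands:
  assumes "ptime I" "ptime D" "ptime A" "ptime W"
  shows "ptime (\<lambda>p. cands (I p) (D p) (A p) (W p))"
  unfolding cands_def
  by (intro ptime_intros ptime_of ptest_arc ptime_highs assms[THEN ptime_comp])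

lemma ptime_goods:
  assumes "ptime I" "ptime D" "ptime A" shows "ptime (\<lambda>p. goods (I p) (D p) (A p))"
  unfolding goods_def by (intro ptime_intros ptime_cands assms[THEN ptime_comp])

lemma ptime_remove:
  assumes "ptime W" "ptime A" shows "ptime (\<lambda>p. remove (W p) (A p))"
  unfolding remove_def by (intro ptime_intros assms[THEN ptime_comp])

lemma ptime_undominated:
  assumes "ptime I" "ptime A" "ptime Y" shows "ptime (\<lambda>p. undominated (I p) (A p) (Y p))"
  unfolding undominated_def by (intro ptime_intros ptest_arc assms[THEN ptime_comp])

lemma ptime_nth_cand:
  assumes "ptime I" "ptime D" "ptime A" "ptime S"
  shows "ptime (\<lambda>p. nth_cand (I p) (D p) (A p) (S p))"
  unfolding nth_cand_def by (intro ptime_intros ptime_cands ptime_goods assms[THEN ptime_comp])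

lemma ptime_step:
  assumes "ptime I" "ptime D" "ptime S" "ptime A"
  shows "ptime (\<lambda>p. step (I p) (D p) (S p) (A p))"
  unfolding step_def
  by (intro ptime_intros ptime_goods ptime_remove ptime_undominated ptime_nth_cand
      assms[THEN ptime_comp])

lemma vsize_filter: "vsize (enc_list (filter Q (vlist v))) \<le> vsize v"
  by (induction v rule: vlist.induct) auto

lemma set_highs: "set (vlist (highs I d A)) \<subseteq> set (vlist (V_of I))"
  by (auto simp: highs_def)

lemma vsize_fst_enc_list:
  assumes "\<And>x. x \<in> set xs \<Longrightarrow> vsize x \<le> b" "1 \<le> b"
  shows "vsize (fst_v (enc_list xs)) \<le> b"
  using assms by (cases xs) auto

lemma vsize_V_of: "vsize (V_of I) \<le> vsize I"
  by (simp add: V_of_def vsize_fst)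

lemma vsize_T_of: "vsize (T_of I) \<le> vsize I"
  unfolding T_of_def by (intro order_trans[OF vsize_fst] order_trans[OF vsize_snd] order_refl)

lemma vsize_nth_cand: "vsize (nth_cand I d A s) \<le> vsize I"
  unfolding nth_cand_def
proof (rule vsize_fst_enc_list)
  show "1 \<le> vsize I" using vsize_pos[of I] by simp
  fix x
  assume "x \<in> set (drop (length (vlist (snd_v s))) (vlist (cands I d A (fst_v (goods I d A)))))"
  then have "x \<in> set (vlist (V_of I))"
    using set_highs[of I d A] by (auto simp: cands_def dest!: in_set_dropD)
  then show "vsize x \<le> vsize I" by (rule order_trans[OF vsize_vlist vsize_V_of])
qed

lemma vsize_snd_step: "vsize (snd_v (step I d s a)) \<le> vsize (snd_v a)"
  by (auto simp: step_def remove_def undominated_def vsize_filter)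

lemma vsize_step: "vsize (step I d s a) \<le> vsize a + (vsize (snd_v a) + vsize I + 3)"
proof -
  have "vsize (fst_v (goods I d (snd_v a))) \<le> vsize (snd_v a)"
    unfolding goods_def by (rule order_trans[OF vsize_fst vsize_filter])
  moreover have "vsize (fst_v a) + vsize (snd_v a) \<le> vsize a + 1" by (cases a) auto
  moreover note vsize_nth_cand[of I d "snd_v a" s]
  moreover have "vsize (remove (fst_v (goods I d (snd_v a))) (snd_v a)) \<le> vsize (snd_v a)"
    unfolding remove_def by (rule vsize_filter)
  moreover have "vsize (undominated I (snd_v a) (nth_cand I d (snd_v a) s)) \<le> vsize (snd_v a)"
    unfolding undominated_def by (rule vsize_filter)
  ultimately show ?thesis unfolding step_def by auto
qed

lemma ptime_run:
  assumes "ptime I" "ptime D" "ptime C" shows "ptime (\<lambda>p. run (I p) (D p) (C p))"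
proof -
  let ?I = "\<lambda>p. fst_v p" and ?D = "\<lambda>p. fst_v (snd_v p)" and ?C = "\<lambda>p. snd_v (snd_v p)"
  have "ptime (\<lambda>p. fold (\<lambda>s a. step (?I p) (?D p) s a) (vlist (?C p)) (Pair_v Nil_v (start (?I p))))"
  \<comment> \<open>The pending terminals only become fewer, while \<open>Q\<close> gains at most
    one entry per step, whose size is bounded by the input.\<close>
  proof (rule ptime_fold_inv[where Inv = "\<lambda>p a. vsize (snd_v a) \<le> vsize (?I p)"
        and c = "\<lambda>s. s + s + 3"])
    show "pb (\<lambda>s. s + s + 3)" by (intro pb.intros)
    show "vsize (snd_v (Pair_v Nil_v (start (?I p)))) \<le> vsize (?I p)" for p
      unfolding start_def snd_v.simps by (rule order_trans[OF vsize_filter vsize_T_of])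
    show "vsize (snd_v (step (?I p) (?D p) x a)) \<le> vsize (?I p)"
      if "vsize (snd_v a) \<le> vsize (?I p)" for p x a
      by (rule order_trans[OF vsize_snd_step that])
    show "vsize (step (?I p) (?D p) x a) \<le> vsize a + (vsize p + vsize p + 3)"
      if "vsize (snd_v a) \<le> vsize (?I p)" for p x a
      using vsize_step[of "?I p" "?D p" x a] that vsize_fst[of p] by linarith
  qed (intro ptime_intros ptime_step ptime_start)+
  from ptime_comp[OF this ptime_Pair[OF assms(1) ptime_Pair[OF assms(2,3)]]]
  show ?thesis by (simp add: run_def)
qed

lemma ptime_mask:
  assumes "ptime Q" "ptime C" shows "ptime (\<lambda>p. mask (Q p) (C p))"
proof -
  have "ptime (\<lambda>p. fold (\<lambda>s a. mask_step s a) (vlist (snd_v p)) (Pair_v Nil_v (fst_v p)))"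
  proof (rule ptime_fold_inv[where Inv = "\<lambda>p a. True" and c = "\<lambda>s. 4"])
    show "vsize (mask_step x a) \<le> vsize a + 4" for x a
      by (cases a; cases "snd_v a") (auto simp: mask_step_def)
    show "ptime (\<lambda>q. mask_step (fst_v q) (fst_v (snd_v q)))"
      unfolding mask_step_def by (intro ptime_intros)
  qed (intro ptime_intros pb.intros TrueI)+
  from ptime_fst[OF ptime_comp[OF this ptime_Pair[OF assms]]] show ?thesis by (simp add: mask_def)
qed

lemma ptime_tails:
  assumes "ptime K" shows "ptime (\<lambda>p. tails (K p))"
proof -
  have "ptime (\<lambda>p. fold (\<lambda>_ a. Pair_v (snd_v (fst_v a)) a) (vlist p) (Pair_v p Nil_v))"
  proof (rule ptime_fold_inv[where Inv = "\<lambda>p a. vsize (fst_v a) \<le> vsize p" and c = "\<lambda>s. s + 1"])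
    show "pb (\<lambda>s. s + 1)" by (intro pb.intros)
    show "vsize (fst_v (Pair_v (snd_v (fst_v a)) a)) \<le> vsize p"
      if "vsize (fst_v a) \<le> vsize p" for p a
      using order_trans[OF vsize_snd that] by simp
    show "vsize (Pair_v (snd_v (fst_v a)) a) \<le> vsize a + (vsize p + 1)"
      if "vsize (fst_v a) \<le> vsize p" for p a
      using order_trans[OF vsize_snd that] by simp
  qed (auto intro!: ptime_intros)
  from ptime_comp[OF this assms] show ?thesis by (simp add: tails_def)
qed

lemma ptime_facts:
  assumes "ptime I" "ptime Q" "ptime B" shows "ptime (\<lambda>p. facts (I p) (Q p) (B p))"
  unfolding facts_def
  by (intro ptime_concat ptime_intros ptime_of ptime_mask ptime_tails assms[THEN ptime_comp])

lemma ptime_weight: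
  assumes "ptime I" "ptime F" shows "ptime (\<lambda>p. weight (I p) (F p))"
  unfolding weight_def by (intro ptime_intros ptest_free assms)

lemma ptest_derivable:
  assumes "ptime I" "ptime M" "ptime F" shows "ptest (\<lambda>p. derivable (I p) (M p) (F p))"
  unfolding derivable_def by (intro ptime_intros ptest_arc ptime_weight assms[THEN ptime_comp])

lemma ptime_derive:
  assumes "ptime I" "ptime U" "ptime M" shows "ptime (\<lambda>p. derive_facts (I p) (U p) (M p))"
  unfolding derive_facts_def by (intro ptime_intros ptest_derivable assms[THEN ptime_comp])

lemma ptime_table:
  assumes "ptime I" "ptime U" shows "ptime (\<lambda>p. table (I p) (U p))"
proof -
  \<comment> \<open>After any round the table is a sublist of the universe \<open>U\<close>.\<close>
  have bound: "vsize (fold (\<lambda>_ M. derive_facts I U M) xs M) \<le> vsize U" if "vsize M \<le> vsize U" for I U M xs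
    using that by (induction xs arbitrary: M) (auto simp: derive_facts_def vsize_filter)
  have "ptime (\<lambda>p. fold (\<lambda>_ M. derive_facts (fst_v p) (snd_v p) M) (vlist (V_of (fst_v p))) Nil_v)"
  proof (rule ptime_fold[where b = "\<lambda>s. s"])
    fix p i
    show "vsize (fold (\<lambda>_ M. derive_facts (fst_v p) (snd_v p) M) (take i (vlist (V_of (fst_v p)))) Nil_v)
        \<le> vsize p"
      by (rule order_trans[OF bound vsize_snd]) (use vsize_pos[of "snd_v p"] in simp)
  qed (intro ptime_intros ptime_of ptime_derive pb.intros)+
  from ptime_comp[OF this ptime_Pair[OF assms]] show ?thesis by (simp add: table_def)
qed

lemma ptest_reaches:
  assumes "ptime I" "ptime Q" "ptime B" shows "ptest (\<lambda>p. reaches (I p) (Q p) (B p))"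
  unfolding reaches_def
  by (intro ptime_intros ptime_of ptime_table ptime_facts assms[THEN ptime_comp])

lemma ptest_accepts:
  assumes "ptime I" "ptime D" "ptime B" "ptime C"
  shows "ptest (\<lambda>p. accepts (I p) (D p) (B p) (C p))"
  unfolding accepts_def by (intro ptime_intros ptime_run ptest_reaches assms)

lemma ptest_stuck:
  assumes "ptime I" "ptime D" "ptime C" shows "ptest (\<lambda>p. stuck (I p) (D p) (C p))"
  unfolding stuck_def by (intro ptime_intros ptime_run ptime_goods assms)

lemma ptime_decide:
  assumes "ptime I" "ptime D" "ptime B" shows "ptime (\<lambda>p. decide (I p) (D p) (B p))"
  unfolding decide_def
  by (intro ptime_intros ptest_accepts ptest_stuck assms[THEN ptime_comp])

lemma ptime_four_dk:
  assumes "ptime I" "ptime D" shows "ptime (\<lambda>p. four_dk (I p) (D p))"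
  unfolding four_dk_def by (intro ptime_concat ptime_intros ptime_of assms[THEN ptime_comp])

text \<open>A single round is polynomial. The exponential size of the certificate list comes from
  iterating it, so \<open>certs\<close> is analysed separately.\<close>

lemma ptime_grow: "ptime grow"
  unfolding grow_def by (intro ptime_concat ptime_intros)

lemma ptime_trunc:
  assumes "ptime N" "ptime A" shows "ptime (\<lambda>p. trunc (N p) (A p))"
  unfolding trunc_def by (intro ptime_intros assms)

lemma ptime_double:
  assumes "ptime A" "ptime B" shows "ptime (\<lambda>p. double (A p) (B p))"
  unfolding double_def by (intro ptime_intros assms)

section \<open>Unary numbers and their truncation\<close>

abbreviation nil_list :: "nat \<Rightarrow> val" where
  "nil_list n \<equiv> enc_list (replicate n Nil_v)"

lemma vsize_nil_list: "vsize (nil_list n) = 2 * n + 1"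
  by (induction n) auto

lemma app_v_nil_list: "app_v (nil_list m) (nil_list n) = nil_list (m + n)"
  by (simp add: app_v_def replicate_add)

lemma double_nil_list: "double (nil_list m) b = nil_list (2 * m + (if b = Nil_v then 0 else 1))"
  by (simp add: double_def app_v_def mult_2 replicate_add replicate_app_Cons_same)

lemma trunc_nil_list: "trunc n (nil_list m) = nil_list (min m (length (vlist n)))"
  by (simp add: trunc_def min_def)

lemma trunc_double:
  "trunc n (double (nil_list m) b) =
     nil_list (min (2 * m + (if b = Nil_v then 0 else 1)) (length (vlist n)))"
  by (simp only: double_nil_list trunc_nil_list)

lemma ptime_unary:
  assumes "ptime N" "ptime K" shows "ptime (\<lambda>p. unary (N p) (K p))"
proof -
  have fold: "\<exists>m\<le>length (vlist n). fold (\<lambda>b a. trunc n (double a b)) bs (nil_list m') = nil_list m"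
    if "m' \<le> length (vlist n)" for n bs m'
    using that
  proof (induction bs arbitrary: m')
    case (Cons b bs)
    then show ?case by (simp add: trunc_double del: enc_list.simps)
  qed auto
  have "ptime (\<lambda>p. fold (\<lambda>b a. trunc (fst_v p) (double a b))
      (vlist (fold Pair_v (vlist (snd_v p)) Nil_v)) Nil_v)"
  proof (rule ptime_fold[where b = "\<lambda>s. 2 * s"])
    fix p i
    let ?xs = "take i (vlist (fold Pair_v (vlist (snd_v p)) Nil_v))"
    obtain m where "m \<le> length (vlist (fst_v p))"
      "fold (\<lambda>b a. trunc (fst_v p) (double a b)) ?xs Nil_v = nil_list m"
      using fold[of 0 "fst_v p" ?xs] by auto
    then show "vsize (fold (\<lambda>b a. trunc (fst_v p) (double a b)) ?xs Nil_v) \<le> 2 * vsize p"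
      using length_vlist[of "fst_v p"] vsize_fst[of p] by (simp add: vsize_nil_list)
  qed (intro ptime_intros ptime_trunc ptime_double ptime_fold_Pair pb.intros)+
  from ptime_comp[OF this ptime_Pair[OF assms]] show ?thesis by (simp add: unary_def)
qed

lemma ptime_prep: "ptime prep"
  unfolding prep_def by (intro ptime_intros ptime_of ptime_unary)

section \<open>Certificates\<close>

definition cert :: "nat list \<Rightarrow> val" where
  "cert ns = enc_list (map nil_list ns)"

definition cost :: "nat list \<Rightarrow> nat" where
  "cost ns = (\<Sum>n\<leftarrow>ns. n + 1)"

lemma cost_simps [simp]: "cost [] = 0" "cost (n # ns) = n + 1 + cost ns"
  by (simp_all add: cost_def)

lemma length_le_cost: "length ns \<le> cost ns"
  by (induction ns) auto

lemma fold_const: "fold (\<lambda>_. f) xs a = (f ^^ length xs) a"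
  by (induction xs arbitrary: a) (auto simp: funpow_swap1)

lemma mem_grow:
  assumes "c \<in> set (vlist B)"
  shows "c \<in> set (vlist (grow B))" "Pair_v Nil_v c \<in> set (vlist (grow B))"
    "Pair_v (Pair_v Nil_v (fst_v c)) (snd_v c) \<in> set (vlist (grow B))"
  using assms by (auto simp: grow_def)

lemma cert_mem_grow_power: "cost ns \<le> i \<Longrightarrow> cert ns \<in> set (vlist ((grow ^^ i) (Pair_v Nil_v Nil_v)))"
proof (induction i arbitrary: ns)
  case 0
  then show ?case by (cases ns) (auto simp: cert_def)
next
  case (Suc i)
  show ?case
  proof (cases ns)
    case Nil
    then show ?thesis using Suc.IH[of "[]"] mem_grow(1) by simp
  next
    case (Cons n ms)
    show ?thesis
    proof (cases n)
      case 0
      then show ?thesis using Suc Cons mem_grow(2)[OF Suc.IH[of ms]] by (simp add: cert_def)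
    next
      case (Suc m)
      then show ?thesis
        using Suc.prems Cons mem_grow(3)[OF Suc.IH[of "m # ms"]] by (simp add: cert_def)
    qed
  qed
qed

lemma cert_mem_certs: "cost ns \<le> length (vlist m) \<Longrightarrow> cert ns \<in> set (vlist (certs m))"
  by (simp add: certs_def fold_const cert_mem_grow_power)

lemma length_four_dk: "length (vlist (four_dk I d)) = 4 * length (vlist d) * length (vlist (K_of I))"
  by (simp add: four_dk_def length_concat comp_def sum_list_triv)

lemma mask_step_simps:
  "mask_step Nil_v (Pair_v R (Pair_v q Q)) = Pair_v R Q"
  "mask_step (Pair_v a b) (Pair_v R (Pair_v q Q)) = Pair_v (Pair_v q R) Q"
  by (simp_all add: mask_step_def)

text \<open>Each target consumes one symbol, 0 to skip it (cost 1) or 1 to select it (cost 2),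
  whence the factor 2. The induction carries along the part \<open>R\<close> selected so
  far.\<close>

lemma mask_exists:
  assumes "X \<subseteq> set (vlist Q)"
  shows "\<exists>ns. cost ns \<le> 2 * length (vlist Q) \<and> set (vlist (mask Q (cert ns))) = X"
proof -
  have "\<exists>ns. cost ns \<le> 2 * length qs \<and>
      set (vlist (fst_v (fold mask_step (map nil_list ns) (Pair_v R (enc_list qs))))) = set (vlist R) \<union> X"
    if "X \<subseteq> set qs" for R qs
    using that
  proof (induction qs arbitrary: R X)
    case Nil
    then show ?case by (intro exI[of _ "[]"]) simp
  next
    case (Cons q qs)
    show ?case
    proof (cases "q \<in> X")
      case True
      obtain ns where "cost ns \<le> 2 * length qs"
        "set (vlist (fst_v (fold mask_step (map nil_list ns) (Pair_v (Pair_v q R) (enc_list qs))))) =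
          set (vlist (Pair_v q R)) \<union> X \<inter> set qs"
        using Cons.IH[of "X \<inter> set qs" "Pair_v q R"] by auto
      then show ?thesis using True Cons.prems
        by (intro exI[of _ "1 # ns"]) (auto simp: mask_step_simps)
    next
      case False
      obtain ns where "cost ns \<le> 2 * length qs"
        "set (vlist (fst_v (fold mask_step (map nil_list ns) (Pair_v R (enc_list qs))))) = set (vlist R) \<union> X"
        using Cons.IH[of X R] Cons.prems False by auto
      then show ?thesis by (intro exI[of _ "0 # ns"]) (auto simp: mask_step_simps)
    qed
  qed
  from this[of "vlist Q" Nil_v] assms show ?thesis by (simp add: mask_def cert_def)
qed

lemma set_tails: "set (vlist (tails (nil_list k))) = nil_list ` {..k}"
proof -
  have "vlist (fold (\<lambda>_ a. Pair_v (snd_v (fst_v a)) a) xs (Pair_v (nil_list k) Nil_v)) =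
      map (\<lambda>i. nil_list (k - i)) (rev [0..<Suc (length xs)])" for xs :: "val list"
  proof (induction xs rule: rev_induct)
    case (snoc x xs)
    let ?a = "fold (\<lambda>_ a. Pair_v (snd_v (fst_v a)) a) xs (Pair_v (nil_list k) Nil_v)"
    have a: "fst_v ?a = nil_list (k - length xs)" using snoc by (cases ?a) auto
    have "snd_v (nil_list n) = nil_list (n - 1)" for n by (cases n) auto
    with a snoc show ?case by (simp del: enc_list.simps)
  qed simp
  from this[of "replicate k Nil_v"] have "set (vlist (tails (nil_list k))) = (\<lambda>i. nil_list (k - i)) ` {0..<Suc k}"
    unfolding tails_def by (simp only: vlist_enc_list set_map set_rev set_upt length_replicate)
  also have "\<dots> = nil_list ` (\<lambda>i. k - i) ` {0..<Suc k}" by (simp only: image_image)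
  also have "(\<lambda>i. k - i) ` {0..<Suc k} = {..k}"
    by (auto simp: image_iff) (metis atLeastLessThan_iff diff_diff_cancel diff_le_self le_imp_less_Suc zero_le)
  finally show ?thesis .
qed

section \<open>Correctness\<close>

locale dst_instance =
  fixes I :: val
  assumes arcs: "arc I u v \<Longrightarrow> u \<in> set (vlist (V_of I)) \<and> v \<in> set (vlist (V_of I))"
    and root: "r_of I \<in> set (vlist (V_of I))"
    and terminals: "set (vlist (T_of I)) \<subseteq> set (vlist (V_of I)) - {r_of I}"
    and distinct_V: "distinct (vlist (V_of I))"
    and distinct_T: "distinct (vlist (T_of I))"
    and K: "K_of I = nil_list (length (vlist (K_of I)))"
    and acyc: "acyclic {(u, v). arc I u v \<and> u \<in> set (vlist (T_of I)) \<and> v \<in> set (vlist (T_of I))}"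
begin

abbreviation "V \<equiv> set (vlist (V_of I))"
abbreviation "T \<equiv> set (vlist (T_of I))"
abbreviation "r \<equiv> r_of I"
abbreviation "k \<equiv> length (vlist (K_of I))"
abbreviation "N \<equiv> V - T - {r}"

text \<open>Only heads are restricted. A walk may thus start at a vertex that is not paid for,
  matching facts that do not count \<open>v\<close>; a walk from \<open>r\<close> stays inside the
  induced subgraph anyway.\<close>

definition into :: "val set \<Rightarrow> (val \<times> val) set" where
  "into S = {(a, b). arc I a b \<and> b \<in> S \<union> T \<union> {r}}"

definition solution :: "val set \<Rightarrow> bool" where
  "solution S \<longleftrightarrow> S \<subseteq> N \<and> card S \<le> k \<and> (\<forall>t\<in>T. (r, t) \<in> (into S)\<^sup>*)"

lemma free_iff: "free I v \<longleftrightarrow> v \<in> T \<union> {r}"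
  by (auto simp: free_def)

lemma into_mono: "S \<subseteq> S' \<Longrightarrow> (into S)\<^sup>* \<subseteq> (into S')\<^sup>*"
  by (rule rtrancl_mono) (auto simp: into_def)

lemma finite_N: "S \<subseteq> N \<Longrightarrow> finite S"
  by (rule finite_subset[of _ V]) auto

section \<open>Soundness of the dynamic program\<close>

definition sound :: "val \<Rightarrow> bool" where
  "sound f \<longleftrightarrow> (\<exists>S\<subseteq>N. card S \<le> length (vlist (snd_v (snd_v f))) \<and>
     (\<forall>x\<in>set (vlist (fst_v (snd_v f))). (fst_v f, x) \<in> (into S)\<^sup>*))"

text \<open>The sets witnessing the two premises are united, and the head of the connecting arc is
  added unless it is free; the sum of the sizes bounds the union even if the sets overlap.\<close>

lemma derive_sound:
  assumes M: "\<forall>g\<in>set (vlist M). sound g" and f: "f \<in> set (vlist (derive_facts I U M))"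
  shows "sound f"
proof -
  from f have "derivable I M f" by (simp add: derive_facts_def)
  then consider (base) "\<forall>x\<in>set (vlist (fst_v (snd_v f))). x = fst_v f"
    | (combine) g h where "g \<in> set (vlist M)" "h \<in> set (vlist M)" "fst_v g = fst_v f"
      "arc I (fst_v f) (fst_v h)"
      "snd_v (snd_v f) = app_v (snd_v (snd_v g)) (app_v (snd_v (snd_v h)) (weight I (fst_v h)))"
      "\<forall>x\<in>set (vlist (fst_v (snd_v f))).
         x \<in> set (vlist (fst_v (snd_v g))) \<or> x \<in> set (vlist (fst_v (snd_v h)))"
    unfolding derivable_def by blast
  then show ?thesis
  proof cases
    case base
    then show ?thesis unfolding sound_def by (intro exI[of _ "{}"]) auto
  next
    case combine
    let ?u = "fst_v h"
    obtain S1 where S1: "S1 \<subseteq> N" "card S1 \<le> length (vlist (snd_v (snd_v g)))"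
      "\<And>x. x \<in> set (vlist (fst_v (snd_v g))) \<Longrightarrow> (fst_v f, x) \<in> (into S1)\<^sup>*"
      using M combine(1,3) unfolding sound_def by metis
    obtain S2 where S2: "S2 \<subseteq> N" "card S2 \<le> length (vlist (snd_v (snd_v h)))"
      "\<And>x. x \<in> set (vlist (fst_v (snd_v h))) \<Longrightarrow> (?u, x) \<in> (into S2)\<^sup>*"
      using M combine(2) unfolding sound_def by metis
    let ?W = "if free I ?u then {} else {?u}"
    let ?S = "S1 \<union> S2 \<union> ?W"
    have sub: "?S \<subseteq> N" using S1(1) S2(1) arcs[OF combine(4)] by (auto simp: free_iff)
    have "card ?S \<le> card S1 + card S2 + card ?W"
      by (meson add_mono card_Un_le order_refl order_trans)
    also have "card ?W = length (vlist (weight I ?u))" by (simp add: weight_def)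
    finally have card: "card ?S \<le> length (vlist (snd_v (snd_v f)))"
      using S1(2) S2(2) combine(5) by simp
    have edge: "(fst_v f, ?u) \<in> into ?S" using combine(4) by (auto simp: into_def free_iff)
    have "(fst_v f, x) \<in> (into ?S)\<^sup>*" if "x \<in> set (vlist (fst_v (snd_v f)))" for x
    proof -
      from combine(6) that consider "x \<in> set (vlist (fst_v (snd_v g)))"
        | "x \<in> set (vlist (fst_v (snd_v h)))" by blast
      then show ?thesis
      proof cases
        case 1
        then show ?thesis using S1(3) into_mono[of S1 ?S] by blast
      next
        case 2
        then have "(?u, x) \<in> (into ?S)\<^sup>*" using S2(3) into_mono[of S2 ?S] by blast
        with edge show ?thesis by (rule converse_rtrancl_into_rtrancl)
      qed
    qed
    with sub card show ?thesis unfolding sound_def by blast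
  qed
qed

lemma table_power: "table I U = (derive_facts I U ^^ card V) Nil_v"
  by (simp add: table_def fold_const distinct_card[OF distinct_V])

lemma derive_power_sound: "\<forall>f\<in>set (vlist ((derive_facts I U ^^ i) Nil_v)). sound f"
  by (induction i) (use derive_sound in auto)

lemma set_facts: "set (vlist (facts I Q B)) =
    {Pair_v v (Pair_v (mask Q c) (nil_list n)) | v c n. v \<in> V \<and> c \<in> set (vlist B) \<and> n \<le> k}"
proof -
  have "set (vlist (tails (K_of I))) = nil_list ` {..k}" using set_tails[of k] K by simp
  then show ?thesis unfolding facts_def vlist_enc_list by (fastforce simp: image_iff)
qed

lemma reaches_sound:
  assumes "reaches I Q B"
  shows "\<exists>S\<subseteq>N. card S \<le> k \<and> (\<forall>x\<in>set (vlist Q). (r, x) \<in> (into S)\<^sup>*)"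
proof -
  let ?U = "facts I Q B"
  from assms obtain f where f: "f \<in> set (vlist (table I ?U))" "fst_v f = r"
    "\<forall>x\<in>set (vlist Q). x \<in> set (vlist (fst_v (snd_v f)))"
    unfolding reaches_def by blast
  have "sound f" using f(1) derive_power_sound unfolding table_power by blast
  then obtain S where S: "S \<subseteq> N" "card S \<le> length (vlist (snd_v (snd_v f)))"
    "\<forall>x\<in>set (vlist (fst_v (snd_v f))). (r, x) \<in> (into S)\<^sup>*"
    unfolding sound_def f(2) by blast
  \<comment> \<open>There is at least one round, so the table is filtered from the universe, whose
    budgets are at most \<open>k\<close>.\<close>
  obtain n where "card V = Suc n" using root by (cases "card V") auto
  then have "f \<in> set (vlist ?U)" using f(1) unfolding table_power by (auto simp: derive_facts_def)
  then have "length (vlist (snd_v (snd_v f))) \<le> k" unfolding set_facts by auto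
  then show ?thesis using S f(3) by (intro exI[of _ S]) auto
qed

text \<open>An out-tree is contracted leaf by leaf, by merging the fact of a leaf into that of its parent.\<close>

inductive grown :: "val set \<Rightarrow> bool" where
  grown_root: "grown {r}"
| grown_arc: "grown R \<Longrightarrow> p \<in> R \<Longrightarrow> arc I p u \<Longrightarrow> u \<notin> R \<Longrightarrow> grown (insert u R)"

lemma grown_finite: "grown R \<Longrightarrow> finite R" and grown_root_mem: "grown R \<Longrightarrow> r \<in> R"
  by (induction rule: grown.induct) auto

text \<open>A grown subset of the reachable set that has maximal size is closed under the arcs of
  \<open>into S\<close>, hence contains every reachable vertex.\<close>

lemma grown_reachable:
  assumes "S \<subseteq> V"
  shows "grown {v. (r, v) \<in> (into S)\<^sup>*}"
proof -
  let ?R = "{v. (r, v) \<in> (into S)\<^sup>*}"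
  have "?R \<subseteq> V"
  proof
    fix v assume "v \<in> ?R"
    then have "(r, v) \<in> (into S)\<^sup>*" by simp
    then show "v \<in> V" by (induction rule: rtrancl_induct) (use root arcs in \<open>auto simp: into_def\<close>)
  qed
  then have fin: "finite ?R" by (rule finite_subset) simp
  let ?P = "\<lambda>G. grown G \<and> G \<subseteq> ?R"
  have 1: "?P {r}" by (auto intro: grown_root)
  have 2: "\<forall>G. ?P G \<longrightarrow> card G < Suc (card ?R)"
    using card_mono[OF fin] by (simp add: less_Suc_eq_le)
  have "\<exists>G. ?P G \<and> (\<forall>G'. ?P G' \<longrightarrow> card G' \<le> card G)"
    by (rule ex_has_greatest_nat[where P = ?P, OF 1 2])
  then obtain G where G: "grown G" "G \<subseteq> ?R" and max: "\<And>G'. ?P G' \<Longrightarrow> card G' \<le> card G"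
    by blast
  have "v \<in> G" if "(r, v) \<in> (into S)\<^sup>*" for v
    using that
  proof (induction rule: rtrancl_induct)
    case base
    show ?case by (rule grown_root_mem[OF G(1)])
  next
    case (step y z)
    show ?case
    proof (rule ccontr)
      assume z: "z \<notin> G"
      have "arc I y z" using step(2) by (simp add: into_def)
      then have "grown (insert z G)" using grown_arc[OF G(1) step(3) _ z] by blast
      moreover have "insert z G \<subseteq> ?R" using G(2) step(1,2) by auto
      ultimately have "card (insert z G) \<le> card G" using max by blast
      then show False using z grown_finite[OF G(1)] by simp
    qed
  qed
  with G have "G = ?R" by blast
  with G(1) show ?thesis by simp
qed

section \<open>Completeness of the dynamic program\<close>

context
  fixes Q B :: val
  assumes masks: "\<And>X. X \<subseteq> set (vlist Q) \<Longrightarrow> \<exists>c\<in>set (vlist B). set (vlist (mask Q c)) = X"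
begin

definition tab :: "nat \<Rightarrow> val set" where
  "tab i = set (vlist ((derive_facts I (facts I Q B) ^^ i) Nil_v))"

text \<open>Masks are lists, and one set of targets may have several; only the set matters
  here.\<close>

definition holds :: "nat \<Rightarrow> val \<Rightarrow> val set \<Rightarrow> nat \<Rightarrow> bool" where
  "holds i v X n \<longleftrightarrow> (\<exists>x. Pair_v v (Pair_v x (nil_list n)) \<in> tab i \<and> set (vlist x) = X)"

definition wt :: "val \<Rightarrow> nat" where
  "wt u = (if u \<in> T \<union> {r} then 0 else 1)"

lemma derive_mono:
  assumes "set (vlist M) \<subseteq> set (vlist M')"
  shows "set (vlist (derive_facts I U M)) \<subseteq> set (vlist (derive_facts I U M'))"
proof
  fix f assume "f \<in> set (vlist (derive_facts I U M))"
  then have "f \<in> set (vlist U)" "derivable I M f" by (auto simp: derive_facts_def)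
  moreover from this(2) have "derivable I M' f"
    unfolding derivable_def using assms by (meson subsetD)
  ultimately show "f \<in> set (vlist (derive_facts I U M'))" by (simp add: derive_facts_def)
qed

lemma tab_Suc: "tab i \<subseteq> tab (Suc i)"
proof (induction i)
  case 0
  then show ?case by (simp add: tab_def)
next
  case (Suc i)
  then show ?case unfolding tab_def by (simp add: derive_mono)
qed

lemma tab_mono: "i \<le> j \<Longrightarrow> tab i \<subseteq> tab j"
  by (rule lift_Suc_mono_le[of tab]) (rule tab_Suc)

lemma holds_mono: "holds i v X n \<Longrightarrow> i \<le> j \<Longrightarrow> holds j v X n"
  using tab_mono unfolding holds_def by blast

lemma holdsI:
  assumes "v \<in> V" "X \<subseteq> set (vlist Q)" "n \<le> k"
    and "\<And>x. set (vlist x) = X \<Longrightarrow>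
      derivable I ((derive_facts I (facts I Q B) ^^ i) Nil_v) (Pair_v v (Pair_v x (nil_list n)))"
  shows "holds (Suc i) v X n"
proof -
  obtain c where c: "c \<in> set (vlist B)" "set (vlist (mask Q c)) = X" using masks assms(2) by blast
  then have "Pair_v v (Pair_v (mask Q c) (nil_list n)) \<in> set (vlist (facts I Q B))"
    using assms(1,3) unfolding set_facts by blast
  then show ?thesis using c(2) assms(4)[OF c(2)] unfolding holds_def tab_def
    by (auto simp: derive_facts_def intro!: exI[of _ "mask Q c"])
qed

lemma holds_base:
  assumes "v \<in> V" "X \<subseteq> set (vlist Q)" "X \<subseteq> {v}"
  shows "holds 1 v X 0"
  using holdsI[of v X 0 0] assms by (auto simp: derivable_def)

text \<open>The new fact appears in round \<open>max i j + 1\<close>, which is at most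
  \<open>i + j\<close> for positive \<open>i\<close> and \<open>j\<close>. The additive count is
  preferred because it can be summed over the vertices of a tree.\<close>

lemma holds_combine:
  assumes "holds i p X a" "holds j u Y b" "0 < i" "0 < j" "arc I p u"
    and "X \<union> Y \<subseteq> set (vlist Q)" "a + b + wt u \<le> k"
  shows "holds (i + j) p (X \<union> Y) (a + b + wt u)"
proof (rule holds_mono[OF holdsI[where i = "max i j"]])
  show "p \<in> V" using arcs[OF assms(5)] by simp
  show "Suc (max i j) \<le> i + j" using assms(3,4) by auto
  let ?M = "(derive_facts I (facts I Q B) ^^ max i j) Nil_v"
  have "holds (max i j) p X a" "holds (max i j) u Y b"
    using assms(1,2) by (auto elim: holds_mono)
  then obtain x' y where x': "Pair_v p (Pair_v x' (nil_list a)) \<in> set (vlist ?M)" "set (vlist x') = X"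
    and y: "Pair_v u (Pair_v y (nil_list b)) \<in> set (vlist ?M)" "set (vlist y) = Y"
    unfolding holds_def tab_def by blast
  have w: "weight I u = nil_list (wt u)" by (simp add: weight_def wt_def free_iff)
  fix x assume x: "set (vlist x) = X \<union> Y"
  show "derivable I ?M (Pair_v p (Pair_v x (nil_list (a + b + wt u))))"
    unfolding derivable_def
    by (rule disjI2, rule bexI[OF _ x'(1)], rule bexI[OF _ y(1)])
      (use x x' y assms(5) in \<open>auto simp: w app_v_nil_list add.assoc\<close>)
qed (use assms in auto)

text \<open>Contracting the leaf \<open>u\<close> into \<open>p\<close> preserves the total, up to
  the charge \<open>c\<close> for entering \<open>u\<close>.\<close>

lemma sum_merge:
  fixes f :: "'a \<Rightarrow> nat"
  assumes "finite R" "p \<in> R" "u \<notin> R"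
  shows "(\<Sum>v\<in>R. (f(p := f p + f u + c)) v) = (\<Sum>v\<in>insert u R. f v) + c"
proof -
  have "(\<Sum>v\<in>R. (f(p := f p + f u + c)) v) = f p + f u + c + (\<Sum>v\<in>R - {p}. f v)"
    using assms by (simp add: sum.remove[of R p])
  moreover have "(\<Sum>v\<in>R. f v) = f p + (\<Sum>v\<in>R - {p}. f v)" using assms by (simp add: sum.remove)
  ultimately show ?thesis using assms by simp
qed

text \<open>Arbitrary facts are allowed at the vertices, because contracting the last leaf changes
  the data of its parent before the induction hypothesis is applied to the smaller tree.\<close>

lemma holds_grown:
  assumes "grown R"
    and "\<And>v. v \<in> R \<Longrightarrow> holds (h v) v (X v) (n v) \<and> 0 < h v \<and> X v \<subseteq> set (vlist Q)"
    and "(\<Sum>v\<in>R. n v) + (\<Sum>v\<in>R. wt v) \<le> k"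
  shows "holds (\<Sum>v\<in>R. h v) r (\<Union>v\<in>R. X v) ((\<Sum>v\<in>R. n v) + (\<Sum>v\<in>R. wt v))"
  using assms
proof (induction arbitrary: h X n rule: grown.induct)
  case grown_root
  then show ?case by (simp add: wt_def)
next
  case (grown_arc R p u)
  have fin: "finite R" by (rule grown_finite[OF grown_arc(1)])
  have pu: "p \<noteq> u" using grown_arc by auto
  \<comment> \<open>The summand 0 brings the term into the shape of
    \<open>sum_merge\<close>.\<close>
  let ?h = "h(p := h p + h u + 0)"
  let ?X = "X(p := X p \<union> X u)"
  let ?n = "n(p := n p + n u + wt u)"
  have hs: "(\<Sum>v\<in>R. ?h v) = (\<Sum>v\<in>insert u R. h v)"
    using sum_merge[OF fin grown_arc(2,4), of h 0] by simp
  have ns: "(\<Sum>v\<in>R. ?n v) + (\<Sum>v\<in>R. wt v) = (\<Sum>v\<in>insert u R. n v) + (\<Sum>v\<in>insert u R. wt v)"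
    using sum_merge[OF fin grown_arc(2,4), of n "wt u"] fin grown_arc(4) by simp
  have Xs: "(\<Union>v\<in>R. ?X v) = (\<Union>v\<in>insert u R. X v)" using grown_arc(2) by (auto split: if_splits)
  have le: "n p + n u + wt u \<le> k"
  proof -
    have "?n p \<le> (\<Sum>v\<in>R. ?n v)" by (rule member_le_sum[OF grown_arc(2)]) (use fin in auto)
    with ns grown_arc.prems(2) show ?thesis by simp
  qed
  have *: "holds (?h v) v (?X v) (?n v) \<and> 0 < ?h v \<and> ?X v \<subseteq> set (vlist Q)" if v: "v \<in> R" for v
  proof (cases "v = p")
    case True
    have P: "holds (h p) p (X p) (n p)" "0 < h p" "X p \<subseteq> set (vlist Q)"
      and U: "holds (h u) u (X u) (n u)" "0 < h u" "X u \<subseteq> set (vlist Q)"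
      using grown_arc.prems(1)[of p] grown_arc.prems(1)[of u] grown_arc(2) by auto
    show ?thesis
      using holds_combine[OF P(1) U(1) P(2) U(2) grown_arc(3) _ le] P U True by simp
  next
    case False
    then show ?thesis using grown_arc.prems(1)[of v] v by simp
  qed
  have "holds (\<Sum>v\<in>R. ?h v) r (\<Union>v\<in>R. ?X v) ((\<Sum>v\<in>R. ?n v) + (\<Sum>v\<in>R. wt v))"
    by (rule grown_arc.IH) (use * ns grown_arc.prems(2) in auto)
  then show ?case unfolding hs ns Xs .
qed

lemma reaches_complete:
  assumes S: "S \<subseteq> N" "card S \<le> k" and Q: "\<And>x. x \<in> set (vlist Q) \<Longrightarrow> (r, x) \<in> (into S)\<^sup>*"
  shows "reaches I Q B"
proof -
  let ?R = "{v. (r, v) \<in> (into S)\<^sup>*}"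
  have g: "grown ?R" by (rule grown_reachable) (use S in auto)
  have fin: "finite ?R" by (rule grown_finite[OF g])
  have R: "?R \<subseteq> S \<union> T \<union> {r}"
  proof
    fix v assume "v \<in> ?R"
    then have "(r, v) \<in> (into S)\<^sup>*" by simp
    then show "v \<in> S \<union> T \<union> {r}" by cases (auto simp: into_def)
  qed
  then have RV: "?R \<subseteq> V" using S terminals root by auto
  have "(\<Sum>v\<in>?R. wt v) = (\<Sum>v\<in>?R. if v \<in> T \<union> {r} then 0 else 1)" by (simp add: wt_def)
  also have "\<dots> = card (?R - (T \<union> {r}))"
    using fin by (simp add: sum.If_cases) (rule arg_cong[of _ _ card], auto)
  also have "\<dots> \<le> card S" using R by (intro card_mono finite_N[OF S(1)]) auto
  finally have w: "(\<Sum>v\<in>?R. wt v) \<le> k" using S by simp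
  \<comment> \<open>Initially every vertex covers only itself, if it is a target, after one round
    and at no cost.\<close>
  have "holds (\<Sum>v\<in>?R. 1) r (\<Union>v\<in>?R. {v} \<inter> set (vlist Q)) ((\<Sum>v\<in>?R. 0) + (\<Sum>v\<in>?R. wt v))"
  proof (rule holds_grown[OF g])
    fix v assume "v \<in> ?R"
    then show "holds 1 v ({v} \<inter> set (vlist Q)) 0 \<and> 0 < (1 :: nat) \<and> {v} \<inter> set (vlist Q) \<subseteq> set (vlist Q)"
      using RV holds_base[of v "{v} \<inter> set (vlist Q)"] by blast
  qed (use w in simp)
  moreover have "(\<Union>v\<in>?R. {v} \<inter> set (vlist Q)) = set (vlist Q)" using Q by auto
  ultimately have "holds (card ?R) r (set (vlist Q)) (\<Sum>v\<in>?R. wt v)" by simp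
  moreover have "card ?R \<le> card V" using RV by (simp add: card_mono)
  ultimately have "holds (card V) r (set (vlist Q)) (\<Sum>v\<in>?R. wt v)" by (rule holds_mono)
  then obtain x where "Pair_v r (Pair_v x (nil_list (\<Sum>v\<in>?R. wt v))) \<in> set (vlist (table I (facts I Q B)))"
    "set (vlist x) = set (vlist Q)"
    unfolding holds_def tab_def table_power by blast
  then show ?thesis unfolding reaches_def by (intro bexI) auto
qed

end

section \<open>Soundness of acceptance\<close>

lemma run_invariant:
  assumes "\<forall>t\<in>X. t \<in> set (vlist (snd_v a)) \<or> t \<in> set (vlist (fst_v a)) \<or>
    (\<exists>y\<in>set (vlist (fst_v a)). arc I y t)"
  shows "\<forall>t\<in>X. t \<in> set (vlist (snd_v (fold (step I d) c a))) \<or>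
    t \<in> set (vlist (fst_v (fold (step I d) c a))) \<or>
    (\<exists>y\<in>set (vlist (fst_v (fold (step I d) c a))). arc I y t)"
  using assms
proof (induction c arbitrary: a)
  case (Cons s c)
  show ?case unfolding fold.simps comp_def
    by (rule Cons.IH) (use Cons.prems in \<open>auto simp: step_def remove_def undominated_def\<close>)
qed simp

text \<open>Acyclicity makes the arcs inside \<open>T\<close> well-founded: a terminal that is not a
  source has an in-neighbour that is the root or an earlier terminal, so reachability spreads from
  the sources.\<close>

lemma all_reachable:
  assumes "\<And>t. t \<in> set (vlist (start I)) \<Longrightarrow> (r, t) \<in> (into S)\<^sup>*" "t \<in> T"
  shows "(r, t) \<in> (into S)\<^sup>*"
proof -
  let ?D = "{(u, v). arc I u v \<and> u \<in> T \<and> v \<in> T}"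
  have "finite ?D" by (rule finite_subset[of _ "T \<times> T"]) auto
  then have "wf ?D" using acyc by (rule finite_acyclic_wf)
  then show ?thesis using assms(2)
  proof (induction t)
    case (less t)
    show ?case
    proof (cases "t \<in> set (vlist (start I))")
      case False
      then obtain u where u: "free I u" "arc I u t" using less.prems by (auto simp: start_def)
      have "(r, u) \<in> (into S)\<^sup>*" using u less by (auto simp: free_iff)
      moreover have "(u, t) \<in> into S" using u less.prems by (simp add: into_def)
      ultimately show ?thesis by (rule rtrancl_into_rtrancl)
    qed (rule assms(1))
  qed
qed

text \<open>Whichever certificate was followed, at the end every source is a target or an
  out-neighbour of a target. Hence acceptance can be trusted even for values of \<open>d\<close>
  below the degeneracy.\<close>

lemma accepts_sound:
  assumes "accepts I d B c"
  shows "\<exists>S. solution S"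
proof -
  let ?Q = "fst_v (run I d c)"
  from assms have A: "snd_v (run I d c) = Nil_v" and Q: "reaches I ?Q B" by (auto simp: accepts_def)
  from reaches_sound[OF Q]
  obtain S where S: "S \<subseteq> N" "card S \<le> k" "\<forall>x\<in>set (vlist ?Q). (r, x) \<in> (into S)\<^sup>*"
    by blast
  have "(r, t) \<in> (into S)\<^sup>*" if t: "t \<in> set (vlist (start I))" for t
  proof -
    have tT: "t \<in> T" using t by (simp add: start_def)
    from run_invariant[of "set (vlist (start I))" "Pair_v Nil_v (start I)" d "vlist c"] t A
    have "t \<in> set (vlist ?Q) \<or> (\<exists>y\<in>set (vlist ?Q). arc I y t)" by (auto simp: run_def)
    then show ?thesis
    proof
      assume "\<exists>y\<in>set (vlist ?Q). arc I y t"
      then obtain y where y: "y \<in> set (vlist ?Q)" "arc I y t" by blast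
      then have "(y, t) \<in> into S" using tT by (simp add: into_def)
      with S(3) y(1) show ?thesis by (blast intro: rtrancl_into_rtrancl)
    qed (use S(3) in blast)
  qed
  then have "solution S" using S all_reachable unfolding solution_def by blast
  then show ?thesis ..
qed

section \<open>Completeness of the branching\<close>

definition deg :: "val \<Rightarrow> val \<Rightarrow> nat" where
  "deg A s = length (vlist (nbrs I A s))"

text \<open>
  The potential of a solution vertex: making one of its neighbours a target costs 1 while its degree
  is at most \<open>d\<close>, and choosing the vertex itself while its degree is larger costs at most \<open>2 d\<close>.
\<close>

definition potential :: "nat \<Rightarrow> val \<Rightarrow> val \<Rightarrow> nat" where
  "potential d A s = (if deg A s \<le> d then deg A s else 2 * d)"

lemma deg_eq: "deg A s = length (filter (arc I s) (vlist A))"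
  by (simp add: deg_def nbrs_def)

text \<open>The value jumps upwards, from at most \<open>d\<close> to \<open>2 * d\<close>, when the
  degree exceeds \<open>d\<close>.\<close>

lemma potential_mono: "deg A s \<le> deg A' s \<Longrightarrow> potential d A s \<le> potential d A' s"
  by (auto simp: potential_def)

lemma potential_sum_decrease:
  assumes "finite S" "s \<in> S" "\<And>s. deg A s \<le> deg A' s" "potential d A s + c \<le> potential d A' s"
  shows "(\<Sum>s\<in>S. potential d A s) + c \<le> (\<Sum>s\<in>S. potential d A' s)"
proof -
  have "(\<Sum>s\<in>S - {s}. potential d A s) \<le> (\<Sum>s\<in>S - {s}. potential d A' s)"
    by (intro sum_mono potential_mono assms)
  with assms show ?thesis by (simp add: sum.remove[OF assms(1,2)])
qed

lemma fst_v_mem: "v \<noteq> Nil_v \<Longrightarrow> fst_v v \<in> set (vlist v)"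
  by (cases v) auto

lemma length_filter_filter_le: "length (filter P (filter Q xs)) \<le> length (filter P xs)"
  by (induction xs) auto

lemma length_filter_remove:
  "w \<in> set xs \<Longrightarrow> P w \<Longrightarrow> length (filter P (filter (\<lambda>t. t \<noteq> w) xs)) < length (filter P xs)"
proof (induction xs)
  case (Cons x xs)
  then show ?case using length_filter_filter_le[of P "\<lambda>t. t \<noteq> w" xs] by auto
qed simp

text \<open>The set \<open>S\<close> dictates the certificate: if a candidate lies in
  \<open>S\<close>, choose it, otherwise put \<open>w\<close> aside. Each symbol is paid for by a
  drop of the total potential, on which the induction runs. The run may end in a stuck state, so
  only the absence of good terminals is claimed.\<close>

lemma guided_run:
  assumes S: "S \<subseteq> N" and A: "\<And>t. t \<in> set (vlist A) \<Longrightarrow> t \<in> T \<and> (\<exists>s\<in>S. arc I s t)"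
  shows "\<exists>ns. cost ns \<le> (\<Sum>s\<in>S. potential (length (vlist d)) A s) \<and>
    (let a = fold (step I d) (map nil_list ns) (Pair_v Q A) in
      goods I d (snd_v a) = Nil_v \<and>
      set (vlist (fst_v a)) \<subseteq> set (vlist Q) \<union> S \<union> T \<and>
      length (vlist (fst_v a)) \<le> length (vlist Q) + length ns)"
  using A
proof (induction "\<Sum>s\<in>S. potential (length (vlist d)) A s" arbitrary: A Q rule: less_induct)
  case less
  let ?d = "length (vlist d)"
  let ?\<Phi> = "\<lambda>A. \<Sum>s\<in>S. potential ?d A s"
  have finS: "finite S" by (rule finite_N[OF S])
  show ?case
  proof (cases "goods I d A = Nil_v")
    case True
    then show ?thesis by (intro exI[of _ "[]"]) (auto simp: Let_def)
  next
    case False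
    define w where "w = fst_v (goods I d A)"
    have "w \<in> set (vlist (goods I d A))" unfolding w_def by (rule fst_v_mem[OF False])
    then have w: "w \<in> set (vlist A)" and few: "length (vlist (cands I d A w)) \<le> ?d"
      by (auto simp: goods_def)
    have wT: "w \<in> T" using less.prems w by blast
    show ?thesis
    proof (cases "\<exists>s\<in>S. s \<in> set (vlist (cands I d A w))")
      case True
      then obtain i where i: "i < length (vlist (cands I d A w))" and sS: "vlist (cands I d A w) ! i \<in> S"
        by (metis in_set_conv_nth)
      define s where "s = vlist (cands I d A w) ! i"
      have "s \<in> set (vlist (cands I d A w))" using i by (simp add: s_def)
      then have high: "\<not> deg A s \<le> ?d" by (simp add: cands_def highs_def deg_def)
      have nth: "nth_cand I d A (nil_list (Suc i)) = s"
        by (simp add: nth_cand_def w_def[symmetric] s_def Cons_nth_drop_Suc[OF i, symmetric])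
      let ?A = "undominated I A s"
      have degs: "deg ?A s' \<le> deg A s'" for s'
        unfolding deg_eq undominated_def vlist_enc_list by (rule length_filter_filter_le)
      have "deg ?A s = 0" by (auto simp: deg_eq undominated_def filter_empty_conv)
      then have dec: "?\<Phi> ?A + 2 * ?d \<le> ?\<Phi> A"
        using high by (intro potential_sum_decrease[OF finS, of s] degs) (auto simp: potential_def s_def sS)
      \<comment> \<open>The symbol \<open>Suc i\<close> costs \<open>i + 2\<close>. As
        \<open>i < ?d\<close>, this is at most \<open>?d + 1\<close>, and \<open>?d\<close> is
        positive.\<close>
      have d: "Suc (Suc i) \<le> 2 * ?d" using i few by linarith
      have "?\<Phi> ?A < ?\<Phi> A" using dec d by linarith
      then obtain ns where ns: "cost ns \<le> ?\<Phi> ?A"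
        "let a = fold (step I d) (map nil_list ns) (Pair_v (Pair_v s Q) ?A) in
          goods I d (snd_v a) = Nil_v \<and>
          set (vlist (fst_v a)) \<subseteq> set (vlist (Pair_v s Q)) \<union> S \<union> T \<and>
          length (vlist (fst_v a)) \<le> length (vlist (Pair_v s Q)) + length ns"
        using less.hyps[of ?A "Pair_v s Q"] less.prems by (auto simp: undominated_def)
      have "step I d (nil_list (Suc i)) (Pair_v Q A) = Pair_v (Pair_v s Q) ?A"
        using False nth by (simp add: step_def)
      then show ?thesis using ns dec d sS
        by (intro exI[of _ "Suc i # ns"]) (auto simp: Let_def s_def simp del: enc_list.simps replicate_Suc)
    next
      case no: False
      obtain s where s: "s \<in> S" "arc I s w" using less.prems w by blast
      \<comment> \<open>A vertex of \<open>S\<close> that dominates \<open>w\<close> without being a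
        candidate is not high, so its potential equals its degree and drops when \<open>w\<close> is
        removed.\<close>
      have "s \<notin> set (vlist (highs I d A))" using no s by (auto simp: cands_def)
      then have low: "deg A s \<le> ?d" using s S by (auto simp: highs_def deg_def free_iff)
      let ?A = "remove w A"
      have degs: "deg ?A s' \<le> deg A s'" for s'
        unfolding deg_eq remove_def vlist_enc_list by (rule length_filter_filter_le)
      have "deg ?A s < deg A s"
        unfolding deg_eq remove_def vlist_enc_list by (rule length_filter_remove[OF w, of "arc I s", OF s(2)])
      then have dec: "?\<Phi> ?A + 1 \<le> ?\<Phi> A"
        using low by (intro potential_sum_decrease[OF finS s(1)] degs) (auto simp: potential_def)
      then have "?\<Phi> ?A < ?\<Phi> A" by simp
      then obtain ns where ns: "cost ns \<le> ?\<Phi> ?A"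
        "let a = fold (step I d) (map nil_list ns) (Pair_v (Pair_v w Q) ?A) in
          goods I d (snd_v a) = Nil_v \<and>
          set (vlist (fst_v a)) \<subseteq> set (vlist (Pair_v w Q)) \<union> S \<union> T \<and>
          length (vlist (fst_v a)) \<le> length (vlist (Pair_v w Q)) + length ns"
        using less.hyps[of ?A "Pair_v w Q"] less.prems by (auto simp: remove_def)
      have "step I d (nil_list 0) (Pair_v Q A) = Pair_v (Pair_v w Q) ?A"
        using False by (simp add: step_def w_def)
      then show ?thesis using ns dec wT
        by (intro exI[of _ "0 # ns"]) (auto simp: Let_def simp del: enc_list.simps replicate_0)
    qed
  qed
qed

text \<open>Guessed vertices become targets, so vertices of \<open>S\<close> that \<open>r\<close>
  does not reach must be discarded first. The rest still dominates the sources, because the last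
  vertex before a source on a walk from \<open>r\<close> is not free.\<close>

lemma solution_reachable_part:
  assumes "solution S"
  obtains S' where "solution S'" "\<And>s. s \<in> S' \<Longrightarrow> (r, s) \<in> (into S')\<^sup>*"
    "\<And>t. t \<in> set (vlist (start I)) \<Longrightarrow> \<exists>s\<in>S'. arc I s t"
proof -
  let ?S = "{s \<in> S. (r, s) \<in> (into S)\<^sup>*}"
  have reach: "(r, v) \<in> (into ?S)\<^sup>*" if "(r, v) \<in> (into S)\<^sup>*" for v
    using that
  proof (induction rule: rtrancl_induct)
    case (step y z)
    have "(r, z) \<in> (into S)\<^sup>*" using step(1,2) by (rule rtrancl_into_rtrancl)
    then have "(y, z) \<in> into ?S" using step(2) by (auto simp: into_def)
    with step(3) show ?case by (rule rtrancl_into_rtrancl)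
  qed simp
  have S: "S \<subseteq> N" "card S \<le> k" "\<forall>t\<in>T. (r, t) \<in> (into S)\<^sup>*" using assms by (auto simp: solution_def)
  have "card ?S \<le> card S" by (rule card_mono[OF finite_N[OF S(1)]]) auto
  then have "solution ?S" using S reach unfolding solution_def by auto
  moreover have "\<exists>s\<in>?S. arc I s t" if t: "t \<in> set (vlist (start I))" for t
  proof -
    have tT: "t \<in> T" using t by (simp add: start_def)
    then have "(r, t) \<in> (into S)\<^sup>*" "t \<noteq> r" using S terminals by auto
    then obtain z where z: "(r, z) \<in> (into S)\<^sup>*" "(z, t) \<in> into S" by (metis rtranclE)
    have arc: "arc I z t" using z(2) by (simp add: into_def)
    have "z \<in> S \<union> T \<union> {r}" using z(1) by cases (auto simp: into_def)
    moreover have "\<not> free I z" using t arc arcs[OF arc] by (auto simp: start_def)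
    ultimately have "z \<in> ?S" using z(1) by (auto simp: free_iff)
    with arc show ?thesis by blast
  qed
  ultimately show ?thesis using that reach by blast
qed

lemma decide_complete:
  assumes "solution S" and B_def: "B = certs (four_dk I d)"
  shows "\<exists>c\<in>set (vlist B). accepts I d B c \<or> stuck I d c"
proof -
  let ?d = "length (vlist d)"
  obtain S' where S': "solution S'" and reach: "\<And>s. s \<in> S' \<Longrightarrow> (r, s) \<in> (into S')\<^sup>*"
    and dom: "\<And>t. t \<in> set (vlist (start I)) \<Longrightarrow> \<exists>s\<in>S'. arc I s t"
    using solution_reachable_part[OF assms(1)] by metis
  have S: "S' \<subseteq> N" "card S' \<le> k" "\<forall>t\<in>T. (r, t) \<in> (into S')\<^sup>*" using S' by (auto simp: solution_def)
  have "\<exists>ns. cost ns \<le> (\<Sum>s\<in>S'. potential ?d (start I) s) \<and>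
    (let a = fold (step I d) (map nil_list ns) (Pair_v Nil_v (start I)) in
      goods I d (snd_v a) = Nil_v \<and>
      set (vlist (fst_v a)) \<subseteq> set (vlist Nil_v) \<union> S' \<union> T \<and>
      length (vlist (fst_v a)) \<le> length (vlist Nil_v) + length ns)"
    by (rule guided_run[OF S(1)]) (use dom in \<open>auto simp: start_def\<close>)
  then obtain ns where ns: "cost ns \<le> (\<Sum>s\<in>S'. potential ?d (start I) s)"
    and good: "goods I d (snd_v (run I d (cert ns))) = Nil_v"
    and targets: "set (vlist (fst_v (run I d (cert ns)))) \<subseteq> S' \<union> T"
    and len: "length (vlist (fst_v (run I d (cert ns)))) \<le> length ns"
    by (auto simp: Let_def run_def cert_def)
  have "(\<Sum>s\<in>S'. potential ?d (start I) s) \<le> card S' * (2 * ?d)"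
    by (rule sum_bounded_above[where 'a = nat, simplified]) (auto simp: potential_def)
  also have "\<dots> \<le> k * (2 * ?d)" using S(2) by simp
  finally have ns2: "cost ns \<le> 2 * (?d * k)" using ns by (simp add: mult_ac)
  have lenB: "length (vlist (four_dk I d)) = 4 * (?d * k)" by (simp add: length_four_dk)
  have cB: "cert ns \<in> set (vlist B)"
    unfolding B_def by (rule cert_mem_certs) (use ns2 lenB in simp)
  have "accepts I d B (cert ns)" if "snd_v (run I d (cert ns)) = Nil_v"
    unfolding accepts_def
  proof (intro conjI that reaches_complete[OF _ S(1,2)])
    let ?Q = "fst_v (run I d (cert ns))"
    fix X assume "X \<subseteq> set (vlist ?Q)"
    then obtain ms where ms: "cost ms \<le> 2 * length (vlist ?Q)" "set (vlist (mask ?Q (cert ms))) = X"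
      using mask_exists by blast
    \<comment> \<open>Every target stems from one symbol of cost at least 1, so there are at most
      \<open>2dk\<close> targets, and their masks cost at most \<open>4dk\<close>.\<close>
    have "cost ms \<le> length (vlist (four_dk I d))" using ms(1) len length_le_cost[of ns] ns2 lenB by linarith
    then have "cert ms \<in> set (vlist B)" unfolding B_def by (rule cert_mem_certs)
    with ms(2) show "\<exists>c\<in>set (vlist B). set (vlist (mask ?Q c)) = X" by blast
  next
    show "(r, x) \<in> (into S')\<^sup>*" if "x \<in> set (vlist (fst_v (run I d (cert ns))))" for x
      using that targets reach S(3) by blast
  qed
  then have "accepts I d B (cert ns) \<or> stuck I d (cert ns)" using good by (auto simp: stuck_def)
  with cB show ?thesis by blast
qed

text \<open>Valid for every \<open>d\<close>: a rejection requires that no certificate is stuck, and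
  then a solution would have led to acceptance.\<close>

lemma solve_correct:
  assumes "solve (Pair_v I d) \<noteq> Nil_v"
  shows "fst_v (solve (Pair_v I d)) = enc_bool (\<exists>S. solution S)"
  using assms accepts_sound decide_complete[OF _ refl, of _ d]
  by (auto simp: solve_def decide_def enc_bool_def split: if_splits)

text \<open>Degeneracy in the form used by the branching, for the bipartite graph between the high
  vertices \<open>H\<close> and the pending terminals \<open>A\<close>.\<close>

definition degen :: "nat \<Rightarrow> bool" where
  "degen d \<longleftrightarrow> (\<forall>H A. H \<subseteq> V \<longrightarrow> A \<subseteq> V \<longrightarrow> H \<inter> A = {} \<longrightarrow> A \<noteq> {} \<longrightarrow>
     (\<forall>h\<in>H. d < card {t \<in> A. arc I h t}) \<longrightarrow> (\<exists>a\<in>A. card {h \<in> H. arc I h a} \<le> d))"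

lemma goods_neq_Nil:
  assumes "degen (length (vlist d))" and A: "set (vlist A) \<subseteq> T" "distinct (vlist A)" "A \<noteq> Nil_v"
  shows "goods I d A \<noteq> Nil_v"
proof -
  let ?H = "set (vlist (highs I d A))" and ?d = "length (vlist d)"
  have ne: "set (vlist A) \<noteq> {}" using A(3) by (cases A) auto
  have sub: "?H \<subseteq> V" "?H \<inter> set (vlist A) = {}" "set (vlist A) \<subseteq> V"
    using A(1) terminals by (auto simp: highs_def free_iff)
  have "?d < card {t \<in> set (vlist A). arc I h t}" if "h \<in> ?H" for h
  proof -
    have "card {t \<in> set (vlist A). arc I h t} = length (filter (arc I h) (vlist A))"
      using distinct_card[OF distinct_filter[OF A(2)]] by simp
    with that show ?thesis by (simp add: highs_def nbrs_def)
  qed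
  then obtain a where a: "a \<in> set (vlist A)" "card {h \<in> ?H. arc I h a} \<le> ?d"
    using assms(1)[unfolded degen_def, rule_format, OF sub(1,3,2) ne] by blast
  have "distinct (vlist (highs I d A))" using distinct_V by (simp add: highs_def)
  then have "length (vlist (cands I d A a)) = card {h \<in> ?H. arc I h a}"
    using distinct_card[OF distinct_filter] by (fastforce simp: cands_def)
  with a have "a \<in> set (vlist (goods I d A))" by (simp add: goods_def)
  then show ?thesis by auto
qed

text \<open>The pending terminals stay distinct members of \<open>T\<close> throughout, so a
  nonempty rest always has a good one and no run gets stuck.\<close>

lemma solve_stops:
  assumes "degen (length (vlist d))"
  shows "solve (Pair_v I d) \<noteq> Nil_v"
proof -
  have inv: "set (vlist (snd_v (fold (step I d) c a))) \<subseteq> T \<and> distinct (vlist (snd_v (fold (step I d) c a)))"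
    if "set (vlist (snd_v a)) \<subseteq> T" "distinct (vlist (snd_v a))" for c a
    using that
  proof (induction c arbitrary: a)
    case (Cons s c)
    show ?case unfolding fold.simps comp_def
      by (rule Cons.IH) (use Cons.prems in \<open>auto simp: step_def remove_def undominated_def\<close>)
  qed simp
  have "\<not> stuck I d c" for c
    using inv[of "Pair_v Nil_v (start I)" "vlist c"] goods_neq_Nil[OF assms] distinct_T
    unfolding stuck_def run_def by (auto simp: start_def)
  then show ?thesis by (simp add: solve_def decide_def)
qed

end

section \<open>The program and its running time\<close>

text \<open>Each word gives rise to three words of slightly larger size; the generous factor 16 is a
  power of two, which suits the final bound.\<close>

lemma vsize_grow: "vsize (grow B) \<le> 16 * vsize B"
proof (induction B rule: vlist.induct)
  case 1
  then show ?case by (simp add: grow_def)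
next
  case (2 c B)
  have "vsize (fst_v c) + vsize (snd_v c) \<le> vsize c + 1" by (cases c) auto
  with 2 show ?case by (simp add: grow_def)
qed

lemma vsize_certs_bound: "vsize (fold (\<lambda>_ B. grow B) xs B) \<le> 16 ^ length xs * vsize B"
proof (induction xs arbitrary: B)
  case (Cons x xs)
  have "vsize (fold (\<lambda>_ B. grow B) xs (grow B)) \<le> 16 ^ length xs * (16 * vsize B)"
    by (rule order_trans[OF Cons.IH]) (simp add: vsize_grow)
  then show ?case by (simp add: mult_ac)
qed simp

lemma vsize_certs: "vsize (certs m) \<le> 3 * 16 ^ length (vlist m)"
  using vsize_certs_bound[of "vlist m" "Pair_v Nil_v Nil_v"] by (simp add: certs_def)

lemma realizes_certs:
  "\<exists>q. pb q \<and> realizes certs (\<lambda>m. q (vsize m + 16 ^ length (vlist m)))"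
proof -
  let ?G = "\<lambda>q. grow (fst_v (snd_v q))"
  have "ptime ?G" by (intro ptime_comp[OF ptime_grow] ptime_fst ptime_snd ptime_id)
  then obtain g where g: "pb g" "realizes ?G (\<lambda>v. g (vsize v))" by (auto simp: ptime_def)
  have unit: "realizes (\<lambda>_. Pair_v Nil_v Nil_v) (\<lambda>_. 1 + 1 + 1)"
    by (intro realizes_Pair realizes_Nil)
  let ?T = "\<lambda>m. fold_time ?G (\<lambda>v. g (vsize v)) m (vlist m) (Pair_v Nil_v Nil_v)"
  have R: "realizes certs (\<lambda>m. 1 + (1 + 1 + 1) + 4 + ?T m)"
    using realizes_fold[OF g(2) realizes_id unit] by (simp add: certs_def[abs_def])
  let ?z = "\<lambda>s. 5 * s + 2"
  let ?q = "\<lambda>s. 8 + (s * (g (?z s) + 22) + 6)"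
  have z: "pb ?z" by (intro pb_add pb_mult pb_const pb_id)
  have q: "pb ?q" by (intro pb_add pb_mult pb_const pb_id pb_comp[OF g(1) z])
  have bound: "1 + (1 + 1 + 1) + 4 + ?T m \<le> ?q (vsize m + 16 ^ length (vlist m))" for m
  proof -
    let ?s = "vsize m + 16 ^ length (vlist m)"
    have "?T m \<le> length (vlist m) * (g (?z ?s) + 22) + 6"
    proof (rule fold_time_bound, rule pb_mono[OF g(1)])
      fix i assume i: "i < length (vlist m)"
      let ?B = "fold (\<lambda>x a. ?G (Pair_v x (Pair_v a m))) (take i (vlist m)) (Pair_v Nil_v Nil_v)"
      have "vsize ?B \<le> 16 ^ i * 3"
        using vsize_certs_bound[of "take i (vlist m)" "Pair_v Nil_v Nil_v"] i by simp
      also have "\<dots> \<le> 16 ^ length (vlist m) * 3"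
        using i by (intro mult_le_mono1 power_increasing) auto
      finally show "vsize (Pair_v (vlist m ! i) (Pair_v ?B m)) \<le> ?z ?s"
        using vsize_vlist[OF nth_mem[OF i]] by simp
    qed
    also have "\<dots> \<le> ?s * (g (?z ?s) + 22) + 6"
      using length_vlist[of m] by (intro add_mono mult_le_mono1) auto
    finally show ?thesis by simp
  qed
  have "realizes certs (\<lambda>m. ?q (vsize m + 16 ^ length (vlist m)))"
    by (rule realizes_mono[OF R bound])
  with q show ?thesis by (intro exI[of _ ?q] conjI)
qed

lemma realizes_solve:
  "\<exists>q. pb q \<and> realizes solve (\<lambda>p. q (vsize p +
     16 ^ (4 * length (vlist (snd_v p)) * length (vlist (K_of (fst_v p))))))"
proof -
  let ?M = "\<lambda>p. four_dk (fst_v p) (snd_v p)"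
  let ?D = "\<lambda>q. decide (fst_v (fst_v q)) (snd_v (fst_v q)) (snd_v q)"
  let ?l = "\<lambda>p. 4 * length (vlist (snd_v p)) * length (vlist (K_of (fst_v p)))"
  have "ptime ?M" by (intro ptime_four_dk ptime_fst ptime_snd ptime_id)
  then obtain m where m: "pb m" "\<And>p. vsize (?M p) \<le> m (vsize p)" "realizes ?M (\<lambda>p. m (vsize p))"
    by (auto simp: ptime_def)
  have "ptime ?D" by (intro ptime_decide ptime_fst ptime_snd ptime_id)
  then obtain g where g: "pb g" "realizes ?D (\<lambda>p. g (vsize p))" by (auto simp: ptime_def)
  obtain c where c: "pb c" "realizes certs (\<lambda>m. c (vsize m + 16 ^ length (vlist m)))"
    using realizes_certs by blast
  let ?C = "\<lambda>p. m (vsize p) + c (vsize (?M p) + 16 ^ length (vlist (?M p))) + 1"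
  let ?T = "\<lambda>p. 1 + ?C p + 1 + g (vsize (Pair_v p (certs (?M p)))) + 1"
  have R: "realizes solve ?T"
    using realizes_comp[OF g(2) realizes_Pair[OF realizes_id realizes_comp[OF c(2) m(3)]]]
    by (simp add: solve_def[abs_def])
  let ?u = "\<lambda>s. m s + s" and ?w = "\<lambda>s. s + 3 * s + 1"
  let ?q = "\<lambda>s. 1 + (m s + c (?u s) + 1) + 1 + g (?w s) + 1"
  have u: "pb ?u" and w: "pb ?w" by (intro pb_add pb_mult pb_const pb_id m(1))+
  have q: "pb ?q" by (intro pb_add pb_const m(1) pb_comp[OF c(1) u] pb_comp[OF g(1) w])
  have "?T p \<le> ?q (vsize p + 16 ^ ?l p)" for p
  proof -
    let ?s = "vsize p + 16 ^ ?l p"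
    have l: "length (vlist (?M p)) = ?l p" by (rule length_four_dk)
    have ms: "m (vsize p) \<le> m ?s" by (rule pb_mono[OF m(1)]) simp
    have "vsize (?M p) + 16 ^ length (vlist (?M p)) \<le> ?u ?s"
      using m(2)[of p] ms unfolding l by linarith
    then have "c (vsize (?M p) + 16 ^ length (vlist (?M p))) \<le> c (?u ?s)" by (rule pb_mono[OF c(1)])
    moreover have "vsize (Pair_v p (certs (?M p))) \<le> ?w ?s"
      using vsize_certs[of "?M p"] unfolding l by simp
    then have "g (vsize (Pair_v p (certs (?M p)))) \<le> g (?w ?s)" by (rule pb_mono[OF g(1)])
    ultimately show ?thesis using ms by linarith
  qed
  then have "realizes solve (\<lambda>p. ?q (vsize p + 16 ^ ?l p))" by (rule realizes_mono[OF R])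
  with q show ?thesis by (intro exI[of _ ?q] conjI)
qed

text \<open>The exponent grows with the round, so the bound for round \<open>j\<close> covers the
  earlier rounds as well, and the search costs at most \<open>j + 1\<close> times that
  bound.\<close>

lemma program_exists:
  "\<exists>P q. pb q \<and> (\<forall>x j. (\<forall>i<j. solve (Pair_v (prep x) (nil_list i)) = Nil_v) \<longrightarrow>
     solve (Pair_v (prep x) (nil_list j)) \<noteq> Nil_v \<longrightarrow>
     (\<exists>t. runs_to P x (fst_v (solve (Pair_v (prep x) (nil_list j)))) t \<and>
        t \<le> q (vsize x + j + 16 ^ (4 * j * length (vlist (K_of (prep x)))))))"
proof -
  let ?N = "\<lambda>p. Pair_v (fst_v p) (Pair_v Nil_v (snd_v p))"
  have "ptime ?N" by (intro ptime_intros)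
  then obtain n where n: "pb n" "realizes ?N (\<lambda>p. n (vsize p))" by (auto simp: ptime_def)
  obtain s where s: "pb s" "realizes solve (\<lambda>p. s (vsize p +
     16 ^ (4 * length (vlist (snd_v p)) * length (vlist (K_of (fst_v p))))))"
    using realizes_solve by blast
  obtain b where b: "pb b" "\<And>x. vsize (prep x) \<le> b (vsize x)" "realizes prep (\<lambda>x. b (vsize x))"
    using ptime_prep by (auto simp: ptime_def)
  have "realizes (\<lambda>x. Pair_v (prep x) Nil_v) (\<lambda>x. b (vsize x) + 1 + 1)"
    by (intro realizes_Pair b realizes_Nil)
  then obtain e1 Q1 where "code_for 1 e1 Q1 (\<lambda>x. Pair_v (prep x) Nil_v) (\<lambda>x. b (vsize x) + 1 + 1)"
    unfolding realizes_def by blast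
  note 1 = code_forD[OF this]
  let ?T = "\<lambda>p. s (vsize p + 16 ^ (4 * length (vlist (snd_v p)) * length (vlist (K_of (fst_v p)))))"
  let ?S = "\<lambda>v j. \<Sum>i\<le>j. 2 * ?T ((?N ^^ i) v) + n (vsize ((?N ^^ i) v)) + 10"
  obtain e2 Q2 where 2: "\<forall>P0 P1 v j. length P0 = 1 + length Q1 \<longrightarrow>
      (\<forall>i<j. solve ((?N ^^ i) v) = Nil_v) \<longrightarrow> solve ((?N ^^ j) v) \<noteq> Nil_v \<longrightarrow>
      evalb (P0 @ Q2 @ P1) [v] e2 (fst_v (solve ((?N ^^ j) v))) (?S v j)"
    using realizes_search[OF s(2) n(2), of "1 + length Q1"] by (elim exE)
  define f where "f = 1 + length Q1 + length Q2"
  \<comment> \<open>Function 0 prepares the instance with \<open>d = 0\<close> and calls position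
    \<open>f\<close>, which starts the search. It precedes the other code, so the first piece is
    compiled for offset 1.\<close>
  define P where "P = [CallE f [e1]] @ Q1 @ Q2 @ [e2]"
  let ?z = "\<lambda>y. b y + 2 * y + 2 + y"
  let ?q = "\<lambda>y. 4 + b y + 1 + (y + 1) * (2 * s (?z y) + n (?z y) + 10)"
  have z: "pb ?z" by (intro pb_add pb_mult pb_const pb_id b(1))
  have q: "pb ?q" by (intro pb_add pb_mult pb_const pb_id b(1) pb_comp[OF s(1) z] pb_comp[OF n(1) z])
  have "\<exists>t. runs_to P x (fst_v (solve (Pair_v (prep x) (nil_list j)))) t \<and>
        t \<le> ?q (vsize x + j + 16 ^ (4 * j * length (vlist (K_of (prep x)))))"
    if nil: "\<forall>i<j. solve (Pair_v (prep x) (nil_list i)) = Nil_v"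
      and stop: "solve (Pair_v (prep x) (nil_list j)) \<noteq> Nil_v" for x j
  proof -
    let ?v = "Pair_v (prep x) Nil_v" and ?k = "length (vlist (K_of (prep x)))"
    let ?y = "vsize x + j + 16 ^ (4 * j * ?k)"
    have N: "(?N ^^ i) ?v = Pair_v (prep x) (nil_list i)" for i by (induction i) auto
    have first: "evalb P [x] e1 ?v (b (vsize x) + 1 + 1)"
      unfolding P_def using 1[of "[CallE f [e1]]" "Q2 @ [e2]" x] by simp
    have nth: "P ! f = e2" by (simp add: P_def f_def nth_append)
    have second: "evalb P [?v] (P ! f) (fst_v (solve (Pair_v (prep x) (nil_list j)))) (?S ?v j)"
      unfolding nth using 2[rule_format, of "[CallE f [e1]] @ Q1" j ?v "[e2]"] nil stop by (simp add: N P_def)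
    have "evalb P [x] (CallE f [e1]) (fst_v (solve (Pair_v (prep x) (nil_list j))))
        (b (vsize x) + 1 + 1 + ?S ?v j + 1)"
      by (rule evalb_Call[OF first _ second]) (simp add: P_def f_def)
    then have "evalb P [x] (CallE 0 [Var 0]) (fst_v (solve (Pair_v (prep x) (nil_list j))))
        (1 + (b (vsize x) + 1 + 1 + ?S ?v j + 1) + 1)"
      by (intro evalb_Call[OF evalb_Var0]) (simp_all add: P_def)
    then obtain t where t: "runs_to P x (fst_v (solve (Pair_v (prep x) (nil_list j)))) t"
      "t \<le> 1 + (b (vsize x) + 1 + 1 + ?S ?v j + 1) + 1"
      by (auto simp: evalb_def runs_to_def)
    have by': "b (vsize x) \<le> b ?y" by (rule pb_mono[OF b(1)]) simp
    have "?S ?v j \<le> of_nat (card {..j}) * (2 * s (?z ?y) + n (?z ?y) + 10)"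
    proof (rule sum_bounded_above)
      fix i assume "i \<in> {..j}"
      then have ij: "i \<le> j" by simp
      then have pw: "(16::nat) ^ (4 * i * ?k) \<le> 16 ^ (4 * j * ?k)"
        by (intro power_increasing mult_le_mono) auto
      have sz: "vsize ((?N ^^ i) ?v) \<le> b ?y + 2 * j + 2"
        unfolding N using b(2)[of x] by' ij by (simp add: vsize_nil_list)
      have "16 ^ (4 * length (vlist (snd_v ((?N ^^ i) ?v))) * length (vlist (K_of (fst_v ((?N ^^ i) ?v)))))
          = (16::nat) ^ (4 * i * ?k)"
        by (simp add: N)
      note pw' = ord_eq_le_trans[OF this pw]
      have arith: "a + e \<le> c + 2 * (v + j + w) + 2 + (v + j + w)"
        if "a \<le> c + 2 * j + 2" "e \<le> w" for a c e v w :: nat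
        using that by simp
      have "?T ((?N ^^ i) ?v) \<le> s (?z ?y)"
        by (rule pb_mono[OF s(1) arith[OF sz pw']])
      moreover have "n (vsize ((?N ^^ i) ?v)) \<le> n (?z ?y)"
        by (rule pb_mono[OF n(1)]) (use sz in simp)
      ultimately show "2 * ?T ((?N ^^ i) ?v) + n (vsize ((?N ^^ i) ?v)) + 10
          \<le> 2 * s (?z ?y) + n (?z ?y) + 10" by linarith
    qed
    also have "\<dots> \<le> (?y + 1) * (2 * s (?z ?y) + n (?z ?y) + 10)" by (intro mult_le_mono1) simp
    finally have "t \<le> ?q ?y" using t(2) by' by linarith
    with t(1) show ?thesis by blast
  qed
  with q show ?thesis by (intro exI[of _ P] exI[of _ ?q]) blast
qed

section \<open>Encoded instances\<close>

text \<open>Used to show that the binary encoding is injective, and to describe \<open>unary\<close>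
  on arbitrary trees.\<close>

fun dec_nat :: "val \<Rightarrow> nat" where
  "dec_nat Nil_v = 0"
| "dec_nat (Pair_v b v) = 2 * dec_nat v + (if b = Nil_v then 0 else 1)"

lemma dec_enc_nat [simp]: "dec_nat (enc_nat n) = n"
proof (induction n rule: enc_nat.induct)
  case (1 n)
  then show ?case by (subst enc_nat.simps) (auto simp: enc_bool_def elim: oddE evenE)
qed

lemma inj_enc_nat: "inj enc_nat"
  by (metis dec_enc_nat injI)

lemma enc_nat_eq_iff [simp]: "enc_nat m = enc_nat n \<longleftrightarrow> m = n"
  using inj_enc_nat by (simp add: inj_eq)

lemma unary_eq: "unary n v = nil_list (min (dec_nat v) (length (vlist n)))"
proof -
  have "foldr (\<lambda>b a. trunc n (double a b)) (vlist v) Nil_v = nil_list (min (dec_nat v) (length (vlist n)))"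
  proof (induction v rule: vlist.induct)
    case (2 b v)
    \<comment> \<open>Cutting off early does not matter: a value that has reached \<open>l\<close>
      does not fall below it by doubling.\<close>
    have "min (2 * min (dec_nat v) l + c) l = min (2 * dec_nat v + c) l" for l c :: nat by auto
    with 2 show ?case by (simp add: trunc_double del: enc_list.simps)
  qed simp
  then show ?thesis by (simp add: unary_def fold_Pair_v foldr_conv_fold)
qed

section \<open>Reachability, acyclicity and degeneracy in digraphs\<close>

lemma rtrancl_map_prod_image:
  assumes "inj f"
  shows "(f a, f b) \<in> (map_prod f f ` R)\<^sup>* \<longleftrightarrow> (a, b) \<in> R\<^sup>*"
proof
  have "\<exists>b. y = f b \<and> (a, b) \<in> R\<^sup>*" if "(f a, y) \<in> (map_prod f f ` R)\<^sup>*" for y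
    using that
  proof (induction rule: rtrancl_induct)
    case (step y z)
    then obtain b c where "y = f b" "(a, b) \<in> R\<^sup>*" "y = f c" "z \<in> f ` (R `` {c})" by auto
    then show ?case using assms by (auto simp: inj_eq intro: rtrancl_into_rtrancl)
  qed blast
  then show "(a, b) \<in> R\<^sup>*" if "(f a, f b) \<in> (map_prod f f ` R)\<^sup>*"
    using that assms by (metis injD)
  show "(f a, f b) \<in> (map_prod f f ` R)\<^sup>*" if "(a, b) \<in> R\<^sup>*"
    using that
  proof (induction rule: rtrancl_induct)
    case (step y z)
    then have "(f y, f z) \<in> map_prod f f ` R" by (auto intro: rev_image_eqI)
    with step(3) show ?case by (rule rtrancl_into_rtrancl)
  qed simp
qed

text \<open>A walk from \<open>u\<close> along arcs with head in \<open>X\<close> never leaves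
  \<open>X\<close>, so restricting heads amounts to passing to the induced subgraph, where every
  walk can be shortened to a path.\<close>

lemma apath_induced_iff:
  assumes "pair_fin_digraph D" "X \<subseteq> pverts D" "u \<in> X"
  shows "(\<exists>p. pre_digraph.apath (with_proj D \<restriction> X) u p v) \<longleftrightarrow> (u, v) \<in> {(a, b) \<in> parcs D. b \<in> X}\<^sup>*"
proof -
  interpret pair_fin_digraph D by fact
  interpret H: wf_digraph "with_proj D \<restriction> X"
    by (rule wf_digraphI_induced[OF induced_induce]) (use assms(2) in simp)
  have ends: "arcs_ends (with_proj D \<restriction> X) = {(a, b) \<in> parcs D. a \<in> X \<and> b \<in> X}"
    by (auto simp: arcs_ends_def arc_to_ends_def image_iff)
  have "(\<exists>p. H.apath u p v) \<longleftrightarrow> (u, v) \<in> rtrancl_on X {(a, b) \<in> parcs D. a \<in> X \<and> b \<in> X}"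
    unfolding H.reachable_apath[symmetric] reachable_def ends by simp
  also have "\<dots> \<longleftrightarrow> (u, v) \<in> {(a, b) \<in> parcs D. b \<in> X}\<^sup>*"
  proof
    assume "(u, v) \<in> rtrancl_on X {(a, b) \<in> parcs D. a \<in> X \<and> b \<in> X}"
    then show "(u, v) \<in> {(a, b) \<in> parcs D. b \<in> X}\<^sup>*"
    proof (induction rule: rtrancl_on_induct)
      case (step y z)
      then have "(y, z) \<in> {(a, b) \<in> parcs D. b \<in> X}" by auto
      with step(5) show ?case by (rule rtrancl_into_rtrancl)
    qed simp
  next
    assume "(u, v) \<in> {(a, b) \<in> parcs D. b \<in> X}\<^sup>*"
    then show "(u, v) \<in> rtrancl_on X {(a, b) \<in> parcs D. a \<in> X \<and> b \<in> X}"
    proof (induction rule: rtrancl_induct)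
      case (step y z)
      then show ?case using in_rtrancl_on_in_F(2)[OF step(3)]
        by (auto intro: rtrancl_on_into_rtrancl_on)
    qed (use assms(3) in simp)
  qed
  finally show ?thesis .
qed

lemma acyclic_induced:
  assumes "pair_fin_digraph D" "X \<subseteq> pverts D" "acyclic_digraph (with_proj D \<restriction> X)"
  shows "acyclic {(a, b) \<in> parcs D. a \<in> X \<and> b \<in> X}"
proof -
  interpret pair_fin_digraph D by fact
  interpret H: wf_digraph "with_proj D \<restriction> X"
    by (rule wf_digraphI_induced[OF induced_induce]) (use assms(2) in simp)
  have ends: "arcs_ends (with_proj D \<restriction> X) = {(a, b) \<in> parcs D. a \<in> X \<and> b \<in> X}"
    by (auto simp: arcs_ends_def arc_to_ends_def image_iff)
  have False if "(v, v) \<in> (arcs_ends (with_proj D \<restriction> X))\<^sup>+" for v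
  proof -
    from that obtain p where "H.awalk v p v" "p \<noteq> []" unfolding H.reachable1_awalk by blast
    then have "H.closed_w p" by (auto simp: H.closed_w_def)
    then show False using H.closed_w_imp_cycle assms(3) unfolding acyclic_digraph_def by blast
  qed
  then show ?thesis unfolding acyclic_def ends by blast
qed

text \<open>Degeneracy is applied to the arcs from \<open>H\<close> to \<open>A\<close>, made
  symmetric. A vertex of degree at most \<open>d\<close> there cannot belong to \<open>H\<close>;
  disjointness makes each degree the number of arcs to or from the other side.\<close>

lemma degenerated_bipartite:
  assumes "pair_fin_digraph D" "degenerated d D" "H \<subseteq> pverts D" "A \<subseteq> pverts D" "H \<inter> A = {}" "A \<noteq> {}"
    and high: "\<And>h. h \<in> H \<Longrightarrow> d < card {t \<in> A. (h, t) \<in> parcs D}"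
  shows "\<exists>a\<in>A. card {h \<in> H. (h, a) \<in> parcs D} \<le> d"
proof -
  interpret pair_fin_digraph D by fact
  let ?F = "{(h, a) \<in> parcs D. h \<in> H \<and> a \<in> A}"
  define G where "G = with_proj \<lparr>pverts = H \<union> A, parcs = ?F \<union> ?F\<inverse>\<rparr>"
  have verts: "verts G = H \<union> A" and arcs: "arcs_ends G = ?F \<union> ?F\<inverse>"
    by (auto simp: G_def)
  have "wf_digraph (with_proj (mk_symmetric (with_proj D)))"
    unfolding wf_digraph_wp_iff by (rule wellformed_mk_symmetric)
  moreover have "wf_digraph G" unfolding G_def wf_digraph_wp_iff by unfold_locales auto
  ultimately have "subgraph G (with_proj (mk_symmetric (with_proj D)))"
    using assms(3,4) unfolding subgraph_def
    by (auto simp: G_def compatible_def parcs_mk_symmetric with_proj_def)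
  moreover have "symmetric G" unfolding symmetric_def arcs by (auto simp: sym_def)
  moreover have "verts G \<noteq> {}" using verts assms(6) by simp
  ultimately have "\<exists>v\<in>verts G. card {w. v \<rightarrow>\<^bsub>G\<^esub> w \<and> w \<noteq> v} \<le> d"
    using assms(2)[unfolded degenerated_def, rule_format, of G] by simp
  then obtain v where v: "v \<in> H \<union> A" "card {w. v \<rightarrow>\<^bsub>G\<^esub> w \<and> w \<noteq> v} \<le> d"
    unfolding verts by blast
  show ?thesis
  proof (cases "v \<in> H")
    case True
    then have "{w. v \<rightarrow>\<^bsub>G\<^esub> w \<and> w \<noteq> v} = {t \<in> A. (v, t) \<in> parcs D}"
      using assms(5) unfolding arcs by auto
    with v(2) high[OF True] show ?thesis by simp
  next
    case False
    then have "{w. v \<rightarrow>\<^bsub>G\<^esub> w \<and> w \<noteq> v} = {h \<in> H. (h, v) \<in> parcs D}"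
      using v(1) unfolding arcs by auto
    with v False show ?thesis by auto
  qed
qed

section \<open>Transfer between a digraph and its code\<close>

locale dst_encoding =
  fixes D :: "nat pair_pre_digraph" and r :: nat and T :: "nat set" and k :: nat and x :: val
  assumes input: "dst_input D r T" and acyc: "acyclic_digraph (with_proj D \<restriction> T)"
    and code: "dst_code D r T k x"
begin

lemma digraph: "pair_fin_digraph D" and r: "r \<in> pverts D" and T: "T \<subseteq> pverts D - {r}"
  using input by (auto simp: dst_input_def)

lemma finite_V: "finite (pverts D)"
  using digraph by (rule pair_fin_digraph.pair_finite_verts)

lemma arcD: "(a, b) \<in> parcs D \<Longrightarrow> a \<in> pverts D \<and> b \<in> pverts D"
proof -
  interpret pair_fin_digraph D by (rule digraph)
  show "(a, b) \<in> parcs D \<Longrightarrow> a \<in> pverts D \<and> b \<in> pverts D" by (auto dest: in_arcsD1 in_arcsD2)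
qed

lemma prep_simps:
  "set (vlist (V_of (prep x))) = enc_nat ` pverts D"
  "arc (prep x) u v \<longleftrightarrow> (u, v) \<in> map_prod enc_nat enc_nat ` parcs D"
  "r_of (prep x) = enc_nat r"
  "set (vlist (T_of (prep x))) = enc_nat ` T"
  "K_of (prep x) = nil_list (min k (card (pverts D)))"
  "distinct (vlist (V_of (prep x)))" "distinct (vlist (T_of (prep x)))"
  "card (pverts D) < vsize x"
proof -
  obtain vs es ts where x: "distinct vs" "set vs = pverts D" "set es = parcs D"
    "distinct ts" "set ts = T"
    "x = enc_list [enc_list (map enc_nat vs), enc_list (map enc_arc es),
       enc_nat r, enc_list (map enc_nat ts), enc_nat k]"
    using code unfolding dst_code_def by blast
  note defs = prep_def V_of_def E_of_def r_of_def T_of_def K_of_def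
  have len: "length vs = card (pverts D)" using x(1,2) distinct_card by metis
  show "set (vlist (V_of (prep x))) = enc_nat ` pverts D" "r_of (prep x) = enc_nat r"
    "set (vlist (T_of (prep x))) = enc_nat ` T"
    using x by (simp_all add: defs)
  have "inj_on enc_nat A" for A by (rule inj_on_subset[OF inj_enc_nat]) simp
  then show "distinct (vlist (V_of (prep x)))" "distinct (vlist (T_of (prep x)))"
    using x by (simp_all add: defs distinct_map)
  show "K_of (prep x) = nil_list (min k (card (pverts D)))"
    using x(6) by (simp add: defs unary_eq len)
  show "arc (prep x) u v \<longleftrightarrow> (u, v) \<in> map_prod enc_nat enc_nat ` parcs D"
    using x(3,6) by (simp add: arc_def defs enc_arc_def image_iff map_prod_def split_beta)
  have "length vs < vsize (enc_list (map enc_nat vs))"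
    using length_vlist[of "enc_list (map enc_nat vs)"] by simp
  also have "\<dots> < vsize x" using x(6) by simp
  finally show "card (pverts D) < vsize x" by (simp add: len)
qed

sublocale I: dst_instance "prep x"
proof
  show "acyclic {(u, v). arc (prep x) u v \<and> u \<in> set (vlist (T_of (prep x))) \<and> v \<in> set (vlist (T_of (prep x)))}"
  proof -
    let ?R = "{(a, b) \<in> parcs D. a \<in> T \<and> b \<in> T}"
    have "finite ?R"
      by (rule finite_subset[of _ "pverts D \<times> pverts D"]) (use arcD finite_V in auto)
    moreover have "acyclic ?R" by (rule acyclic_induced[OF digraph _ acyc]) (use T in auto)
    ultimately have "wf (map_prod enc_nat enc_nat ` ?R)"
      by (intro wf_map_prod_image finite_acyclic_wf inj_enc_nat)
    then have "acyclic (map_prod enc_nat enc_nat ` ?R)" by (rule wf_acyclic)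
    moreover have "{(u, v). arc (prep x) u v \<and> u \<in> set (vlist (T_of (prep x))) \<and>
        v \<in> set (vlist (T_of (prep x)))} = map_prod enc_nat enc_nat ` ?R"
      unfolding prep_simps by auto
    ultimately show ?thesis by simp
  qed
qed (use arcD r T prep_simps in \<open>auto simp: prep_simps\<close>)

lemma into_image:
  "I.into (enc_nat ` S) = map_prod enc_nat enc_nat ` {(a, b) \<in> parcs D. b \<in> S \<union> T \<union> {r}}"
  unfolding I.into_def prep_simps by auto

lemma solution_image:
  assumes "S \<subseteq> pverts D"
  shows "I.solution (enc_nat ` S) \<longleftrightarrow> S \<subseteq> pverts D - (T \<union> {r}) \<and> card S \<le> k \<and>
    (\<forall>t\<in>T. \<exists>p. pre_digraph.apath (with_proj D \<restriction> (S \<union> T \<union> {r})) r p t)"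
proof -
  have "(\<exists>p. pre_digraph.apath (with_proj D \<restriction> (S \<union> T \<union> {r})) r p t) \<longleftrightarrow>
      (enc_nat r, enc_nat t) \<in> (I.into (enc_nat ` S))\<^sup>*" for t
    unfolding into_image rtrancl_map_prod_image[OF inj_enc_nat]
    by (rule apath_induced_iff[OF digraph]) (use assms r T in auto)
  moreover have "enc_nat ` S \<subseteq> enc_nat ` pverts D - enc_nat ` T - {enc_nat r} \<longleftrightarrow>
      S \<subseteq> pverts D - (T \<union> {r})"
    by auto
  moreover have "card (enc_nat ` S) = card S"
    by (rule card_image[OF inj_on_subset[OF inj_enc_nat]]) simp
  moreover have "card S \<le> card (pverts D)" by (rule card_mono[OF finite_V assms])
  ultimately show ?thesis unfolding I.solution_def prep_simps by auto
qed

lemma ex_solution_iff: "(\<exists>S. I.solution S) \<longleftrightarrow> dst_yes D r T k"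
proof
  assume "\<exists>S. I.solution S"
  then obtain S' where S': "I.solution S'" by blast
  then have "S' \<subseteq> enc_nat ` pverts D" unfolding I.solution_def prep_simps by auto
  then obtain S where S: "S \<subseteq> pverts D" "S' = enc_nat ` S" by (auto simp: subset_image_iff)
  show "dst_yes D r T k"
    using S' unfolding S(2) solution_image[OF S(1)] dst_yes_def by blast
next
  assume "dst_yes D r T k"
  then obtain S where S: "S \<subseteq> pverts D - (T \<union> {r})" "card S \<le> k"
    "\<forall>t\<in>T. \<exists>p. pre_digraph.apath (with_proj D \<restriction> (S \<union> T \<union> {r})) r p t"
    unfolding dst_yes_def by blast
  have "S \<subseteq> pverts D" using S(1) by blast
  from solution_image[OF this] S show "\<exists>S. I.solution S" by blast
qed

text \<open>No vertex has more in-neighbours than there are vertices, so \<open>d\<close> may be cut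
  off there. Thus the search ends after polynomially many rounds even if \<open>d\<close> is
  huge.\<close>

lemma degenI:
  assumes "degenerated d D"
  shows "I.degen (min d (card (pverts D)))"
  unfolding I.degen_def
proof (intro allI impI)
  let ?d = "min d (card (pverts D))"
  fix H' A' assume "H' \<subseteq> set (vlist (V_of (prep x)))" "A' \<subseteq> set (vlist (V_of (prep x)))"
  then obtain H A where H: "H \<subseteq> pverts D" "H' = enc_nat ` H" and A: "A \<subseteq> pverts D" "A' = enc_nat ` A"
    unfolding prep_simps by (auto simp: subset_image_iff)
  assume disj: "H' \<inter> A' = {}" and ne: "A' \<noteq> {}"
    and high: "\<forall>h\<in>H'. ?d < card {t \<in> A'. arc (prep x) h t}"
  have inj: "inj_on enc_nat B" for B by (rule inj_on_subset[OF inj_enc_nat]) simp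
  have out: "card {t \<in> A'. arc (prep x) (enc_nat h) t} = card {t \<in> A. (h, t) \<in> parcs D}" for h
  proof -
    have "{t \<in> A'. arc (prep x) (enc_nat h) t} = enc_nat ` {t \<in> A. (h, t) \<in> parcs D}"
      unfolding A(2) prep_simps by auto
    then show ?thesis by (simp add: card_image[OF inj])
  qed
  have inn: "card {h \<in> H'. arc (prep x) h (enc_nat a)} = card {h \<in> H. (h, a) \<in> parcs D}" for a
  proof -
    have "{h \<in> H'. arc (prep x) h (enc_nat a)} = enc_nat ` {h \<in> H. (h, a) \<in> parcs D}"
      unfolding H(2) prep_simps by auto
    then show ?thesis by (simp add: card_image[OF inj])
  qed
  have "\<exists>a\<in>A. card {h \<in> H. (h, a) \<in> parcs D} \<le> ?d"
  proof (cases "d \<le> card (pverts D)")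
    case True
    have "\<exists>a\<in>A. card {h \<in> H. (h, a) \<in> parcs D} \<le> d"
      by (rule degenerated_bipartite[OF digraph assms H(1) A(1)])
        (use disj ne high True out in \<open>auto simp: H(2) A(2)\<close>)
    then show ?thesis using True by simp
  next
    case False
    obtain a where "a \<in> A" using ne A(2) by auto
    moreover have "card {h \<in> H. (h, a) \<in> parcs D} \<le> card (pverts D)"
      by (rule card_mono[OF finite_V]) (use H(1) in auto)
    ultimately show ?thesis using False by (intro bexI[of _ a]) auto
  qed
  then show "\<exists>a\<in>A'. card {h \<in> H'. arc (prep x) h a} \<le> ?d" unfolding A(2) by (auto simp: inn)
qed

lemma search_succeeds:
  assumes "degenerated d D"
  obtains j where "j \<le> d" "j < vsize x" "\<And>i. i < j \<Longrightarrow> solve (Pair_v (prep x) (nil_list i)) = Nil_v"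
    "solve (Pair_v (prep x) (nil_list j)) \<noteq> Nil_v"
    "fst_v (solve (Pair_v (prep x) (nil_list j))) = enc_bool (dst_yes D r T k)"
proof -
  let ?P = "\<lambda>j. solve (Pair_v (prep x) (nil_list j)) \<noteq> Nil_v"
  let ?d = "min d (card (pverts D))"
  have d: "?P ?d" by (rule I.solve_stops) (use degenI[OF assms] in simp)
  define j where "j = (LEAST j. ?P j)"
  have j: "?P j" unfolding j_def using d by (rule LeastI)
  have "j \<le> ?d" unfolding j_def using d by (rule Least_le)
  then have "j \<le> d" "j < vsize x" using prep_simps(8) by auto
  moreover have "solve (Pair_v (prep x) (nil_list i)) = Nil_v" if "i < j" for i
    using not_less_Least[of i ?P] that unfolding j_def by blast
  moreover have "fst_v (solve (Pair_v (prep x) (nil_list j))) = enc_bool (dst_yes D r T k)"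
    using I.solve_correct[OF j] by (simp add: ex_solution_iff)
  ultimately show ?thesis using that j by blast
qed

end

theorem theorem5:
  shows "\<exists>(P :: prog) (c :: nat). \<forall>(D :: nat pair_pre_digraph) r T k d x.
           dst_input D r T \<longrightarrow> degenerated d D \<longrightarrow> acyclic_digraph (with_proj D \<restriction> T) \<longrightarrow>
           dst_code D r T k x \<longrightarrow>
           (\<exists>t. runs_to P x (enc_bool (dst_yes D r T k)) t \<and>
                t \<le> c * 2 ^ (c * d * k) * vsize x ^ c)"
proof -
  obtain P q where q: "pb q" and P: "\<And>x j. (\<forall>i<j. solve (Pair_v (prep x) (nil_list i)) = Nil_v) \<Longrightarrow>
     solve (Pair_v (prep x) (nil_list j)) \<noteq> Nil_v \<Longrightarrow>
     \<exists>t. runs_to P x (fst_v (solve (Pair_v (prep x) (nil_list j)))) t \<and>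
        t \<le> q (vsize x + j + 16 ^ (4 * j * length (vlist (K_of (prep x)))))"
    using program_exists by blast
  \<comment> \<open>The input size, \<open>j\<close> and the exponential are each at most the
    product of input size and exponential, whence the factor 3.\<close>
  have "pb (\<lambda>s. q (3 * s))" by (rule pb_comp[OF q]) (intro pb_mult pb_const pb_id)
  then obtain c where c: "\<And>s. s \<ge> 1 \<Longrightarrow> q (3 * s) \<le> c * s ^ c" using pb_bound by blast
  show ?thesis
  \<comment> \<open>\<open>16 ^ (4 * j * k)\<close> equals \<open>2 ^ (16 * j * k)\<close>, and a
    polynomial of degree \<open>c\<close> multiplies the exponent by \<open>c\<close>.\<close>
  proof (rule exI[of _ P], rule exI[of _ "16 * c"], intro allI impI)
    fix D :: "nat pair_pre_digraph" and r T k d x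
    assume A: "dst_input D r T" "degenerated d D" "acyclic_digraph (with_proj D \<restriction> T)" "dst_code D r T k x"
    then interpret dst_encoding D r T k x by unfold_locales
    obtain j where j: "j \<le> d" "j < vsize x" "\<And>i. i < j \<Longrightarrow> solve (Pair_v (prep x) (nil_list i)) = Nil_v"
      "solve (Pair_v (prep x) (nil_list j)) \<noteq> Nil_v"
      and ans: "fst_v (solve (Pair_v (prep x) (nil_list j))) = enc_bool (dst_yes D r T k)"
      using search_succeeds[OF A(2)] by metis
    obtain t where t: "runs_to P x (enc_bool (dst_yes D r T k)) t"
      "t \<le> q (vsize x + j + 16 ^ (4 * j * length (vlist (K_of (prep x)))))"
      using P[of j x] j(3,4) unfolding ans by blast
    let ?s = "vsize x" and ?p = "2 ^ (16 * d * k) :: nat"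
    have "(16::nat) ^ (4 * j * length (vlist (K_of (prep x)))) = 2 ^ (4 * (4 * j * length (vlist (K_of (prep x)))))"
      by (simp add: power_mult)
    also have "\<dots> \<le> ?p"
      using j(1) by (intro power_increasing) (auto simp: prep_simps mult.assoc intro!: mult_le_mono)
    finally have "?s + j + 16 ^ (4 * j * length (vlist (K_of (prep x)))) \<le> ?s + ?s + ?p"
      using j(2) by simp
    also have "\<dots> \<le> 3 * (?s * ?p)"
    proof -
      have "?s \<le> ?s * ?p" "?p \<le> ?s * ?p" using vsize_pos[of x] by simp_all
      then show ?thesis by linarith
    qed
    finally have "t \<le> q (3 * (?s * ?p))" using t(2) pb_mono[OF q] order_trans by blast
    also have "\<dots> \<le> c * (?s * ?p) ^ c" by (rule c) (use vsize_pos[of x] in simp)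
    also have "\<dots> = c * 2 ^ (16 * c * d * k) * ?s ^ c"
      by (simp add: power_mult_distrib power_mult[symmetric] mult_ac)
    also have "\<dots> \<le> (16 * c) * 2 ^ (16 * c * d * k) * ?s ^ (16 * c)"
      using vsize_pos[of x] by (intro mult_le_mono power_increasing) auto
    finally show "\<exists>t. runs_to P x (enc_bool (dst_yes D r T k)) t \<and>
        t \<le> 16 * c * 2 ^ (16 * c * d * k) * vsize x ^ (16 * c)"
      using t(1) by blast
  qed
qed

end
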